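(* Let $R$ be a $um$-ring and $M$ an $R$-module. (1) If $F$ is a flat $R$-module and $N$ is a weakly classical prime submodule of $M$ such that $F\otimes_R N\neq F\otimes_R M$, then $F\otimes_R N$ is a weakly classical prime submodule of the $R$-module $F\otimes_R M$. (2) Suppose that $F$ is a faithfully flat $R$-module and $N$ is a submodule of $M$. Then $N$ is a weakly classical prime submodule of $M$ if and only if $F\otimes_R N$ is a weakly classical prime submodule of $F\otimes_R M$.
   Context: All rings are commutative with nonzero identity and all modules are unitary. A $um$-ring is a ring $R$ such that any $R$-module which is equal to a finite union of submodules is equal to one of them. A proper submodule $N$ of an $R$-module $M$ is weakly classical prime if whenever $a,b\in R$ and $m\in M$ with $0\neq abm\in N$, then $am\in N$ or $bm\in N$. For flat $F$ and a submodule $N$ of $M$, $F\otimes_R N$ is identified with its image in $F\otimes_R M$ under the injective map induced by the inclusion $N\subseteq M$. *)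

theory Defs
  imports "HOL-Algebra.Free_Abelian_Groups" "HOL-Algebra.Generated_Groups" "HOL-Algebra.Module"
    "HOL-Algebra.AbelCoset"
begin

definition mod_hom ::
    "('r, 'x) ring_scheme \<Rightarrow> ('r, 'a, 'y) module_scheme \<Rightarrow> ('r, 'b, 'z) module_scheme \<Rightarrow> ('a \<Rightarrow> 'b) set"
  where "mod_hom R A B = {f \<in> hom (add_monoid A) (add_monoid B).
     \<forall>r\<in>carrier R. \<forall>x\<in>carrier A. f (r \<odot>\<^bsub>A\<^esub> x) = r \<odot>\<^bsub>B\<^esub> f x}"

definition tensor_rel ::
    "('r, 'x) ring_scheme \<Rightarrow> ('r, 'f, 'y) module_scheme \<Rightarrow> ('r, 'm, 'z) module_scheme
      \<Rightarrow> (('f \<times> 'm) \<Rightarrow>\<^sub>0 int) set"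
  where "tensor_rel R F M =
     {frag_of (x \<oplus>\<^bsub>F\<^esub> x', m) - frag_of (x, m) - frag_of (x', m) | x x' m.
        x \<in> carrier F \<and> x' \<in> carrier F \<and> m \<in> carrier M} \<union>
     {frag_of (x, m \<oplus>\<^bsub>M\<^esub> m') - frag_of (x, m) - frag_of (x, m') | x m m'.
        x \<in> carrier F \<and> m \<in> carrier M \<and> m' \<in> carrier M} \<union>
     {frag_of (r \<odot>\<^bsub>F\<^esub> x, m) - frag_of (x, r \<odot>\<^bsub>M\<^esub> m) | r x m.
        r \<in> carrier R \<and> x \<in> carrier F \<and> m \<in> carrier M}"

definition tensor_free ::
    "('r, 'f, 'y) module_scheme \<Rightarrow> ('r, 'm, 'z) module_scheme \<Rightarrow> (('f \<times> 'm) \<Rightarrow>\<^sub>0 int) monoid"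
  where "tensor_free F M = free_Abelian_group (carrier F \<times> carrier M)"

definition tensor_ker ::
    "('r, 'x) ring_scheme \<Rightarrow> ('r, 'f, 'y) module_scheme \<Rightarrow> ('r, 'm, 'z) module_scheme
      \<Rightarrow> (('f \<times> 'm) \<Rightarrow>\<^sub>0 int) set"
  where "tensor_ker R F M = generate (tensor_free F M) (tensor_rel R F M)"

definition tensor_push :: "('f \<Rightarrow> 'g) \<Rightarrow> ('a \<Rightarrow> 'b) \<Rightarrow> (('f \<times> 'a) \<Rightarrow>\<^sub>0 int) \<Rightarrow> (('g \<times> 'b) \<Rightarrow>\<^sub>0 int)"
  where "tensor_push g f = frag_extend (\<lambda>(x, a). frag_of (g x, f a))"

text \<open>
  The tensor product is the free abelian group on the product of the carriers, modulo the subgroup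
  generated by the bilinearity relations. Its elements are cosets. Adding this
  subgroup to the image of a coset under a map of free groups that respects the relations gives the
  image coset; scalar multiplication and induced maps are written this way. The record type
  demands ring-multiplication fields, which are irrelevant for a module.
\<close>

definition tensor_module ::
    "('r, 'x) ring_scheme \<Rightarrow> ('r, 'f, 'y) module_scheme \<Rightarrow> ('r, 'm, 'z) module_scheme
      \<Rightarrow> ('r, (('f \<times> 'm) \<Rightarrow>\<^sub>0 int) set) module"
  where "tensor_module R F M =
    \<lparr> carrier = carrier (tensor_free F M Mod tensor_ker R F M),
      monoid.mult = (\<lambda>_ _. undefined), one = undefined,
      zero = \<one>\<^bsub>tensor_free F M Mod tensor_ker R F M\<^esub>,
      add = monoid.mult (tensor_free F M Mod tensor_ker R F M),
      smult = (\<lambda>r X. tensor_ker R F M <#>\<^bsub>tensor_free F M\<^esub>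
                        tensor_push (\<lambda>x. r \<odot>\<^bsub>F\<^esub> x) id ` X) \<rparr>"

definition tensor_elem ::
    "('r, 'x) ring_scheme \<Rightarrow> ('r, 'f, 'y) module_scheme \<Rightarrow> ('r, 'm, 'z) module_scheme
      \<Rightarrow> 'f \<Rightarrow> 'm \<Rightarrow> (('f \<times> 'm) \<Rightarrow>\<^sub>0 int) set"
  where "tensor_elem R F M x m = tensor_ker R F M #>\<^bsub>tensor_free F M\<^esub> frag_of (x, m)"

text \<open>The map \<open>id \<otimes> f\<close> into \<open>F \<otimes> B\<close>, for a homomorphism \<open>f\<close> with codomain \<open>B\<close>.\<close>

definition tensor_map ::
    "('r, 'x) ring_scheme \<Rightarrow> ('r, 'f, 'y) module_scheme \<Rightarrow> ('r, 'b, 'z) module_scheme \<Rightarrow> ('a \<Rightarrow> 'b)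
      \<Rightarrow> (('f \<times> 'a) \<Rightarrow>\<^sub>0 int) set \<Rightarrow> (('f \<times> 'b) \<Rightarrow>\<^sub>0 int) set"
  where "tensor_map R F B f X =
    tensor_ker R F B <#>\<^bsub>tensor_free F B\<^esub> tensor_push id f ` X"

text \<open>The image of \<open>F \<otimes> N\<close> in \<open>F \<otimes> M\<close> under the map induced by the inclusion of \<open>N\<close> in \<open>M\<close>.\<close>

definition tensor_submodule ::
    "('r, 'x) ring_scheme \<Rightarrow> ('r, 'f, 'y) module_scheme \<Rightarrow> ('r, 'm, 'z) module_scheme \<Rightarrow> 'm set
      \<Rightarrow> (('f \<times> 'm) \<Rightarrow>\<^sub>0 int) set set"
  where "tensor_submodule R F M N =
    tensor_map R F M id ` carrier (tensor_module R F (M\<lparr>carrier := N\<rparr>))"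

text \<open>
  A formula cannot quantify over the modules of all types. The three notions \<open>um_ring\<close>,
  \<open>flat_module\<close> and \<open>faithfully_flat_module\<close> therefore quantify over the modules with carrier in
  \<open>'r list\<close>, where \<open>'r\<close> is the type of ring elements. Every finitely generated module is isomorphic
  to one of these, since an element is determined by a list of coefficients, and that suffices: the
  theorems \<open>um_ringD\<close>, \<open>flat_moduleD\<close> and \<open>faithfully_flat_moduleD\<close> at the end derive the
  respective property for modules with carriers of arbitrary types.
\<close>

definition um_ring :: "('r, 'x) ring_scheme \<Rightarrow> bool"
  where "um_ring R \<longleftrightarrow> cring R \<and> \<one>\<^bsub>R\<^esub> \<noteq> \<zero>\<^bsub>R\<^esub> \<and>
    (\<forall>(M :: ('r, 'r list) module) \<N>. module R M \<longrightarrow> finite \<N> \<longrightarrow> (\<forall>N\<in>\<N>. submodule N R M) \<longrightarrow>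
       carrier M = \<Union>\<N> \<longrightarrow> carrier M \<in> \<N>)"

definition flat_module :: "('r, 'x) ring_scheme \<Rightarrow> ('r, 'f, 'y) module_scheme \<Rightarrow> bool"
  where "flat_module R F \<longleftrightarrow> module R F \<and>
    (\<forall>(A :: ('r, 'r list) module) (B :: ('r, 'r list) module) f.
       module R A \<longrightarrow> module R B \<longrightarrow> f \<in> mod_hom R A B \<longrightarrow> inj_on f (carrier A) \<longrightarrow>
       inj_on (tensor_map R F B f) (carrier (tensor_module R F A)))"

definition exact_at ::
    "('r, 'a, 'x) module_scheme \<Rightarrow> ('a \<Rightarrow> 'b) \<Rightarrow> ('r, 'b, 'y) module_scheme \<Rightarrow> ('b \<Rightarrow> 'c)
      \<Rightarrow> ('r, 'c, 'z) module_scheme \<Rightarrow> bool"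
  where "exact_at A f B g C \<longleftrightarrow> f ` carrier A = a_kernel B C g"

definition faithfully_flat_module ::
    "('r, 'x) ring_scheme \<Rightarrow> ('r, 'f, 'y) module_scheme \<Rightarrow> bool"
  where "faithfully_flat_module R F \<longleftrightarrow> module R F \<and>
    (\<forall>(A :: ('r, 'r list) module) (B :: ('r, 'r list) module) (C :: ('r, 'r list) module) f g.
       module R A \<longrightarrow> module R B \<longrightarrow> module R C \<longrightarrow> f \<in> mod_hom R A B \<longrightarrow> g \<in> mod_hom R B C \<longrightarrow>
       (exact_at A f B g C \<longleftrightarrow>
        exact_at (tensor_module R F A) (tensor_map R F B f) (tensor_module R F B)
          (tensor_map R F C g) (tensor_module R F C)))"

definition weakly_classical_prime ::
    "('r, 'x) ring_scheme \<Rightarrow> ('r, 'm, 'y) module_scheme \<Rightarrow> 'm set \<Rightarrow> bool"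
  where "weakly_classical_prime R M N \<longleftrightarrow> submodule N R M \<and> N \<noteq> carrier M \<and>
    (\<forall>a\<in>carrier R. \<forall>b\<in>carrier R. \<forall>m\<in>carrier M.
       (a \<otimes>\<^bsub>R\<^esub> b) \<odot>\<^bsub>M\<^esub> m \<noteq> \<zero>\<^bsub>M\<^esub> \<longrightarrow> (a \<otimes>\<^bsub>R\<^esub> b) \<odot>\<^bsub>M\<^esub> m \<in> N \<longrightarrow>
       a \<odot>\<^bsub>M\<^esub> m \<in> N \<or> b \<odot>\<^bsub>M\<^esub> m \<in> N)"

lemma mod_homI:
  assumes "\<And>x. x \<in> carrier A \<Longrightarrow> f x \<in> carrier B"
    and "\<And>x y. x \<in> carrier A \<Longrightarrow> y \<in> carrier A \<Longrightarrow> f (x \<oplus>\<^bsub>A\<^esub> y) = f x \<oplus>\<^bsub>B\<^esub> f y"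
    and "\<And>r x. r \<in> carrier R \<Longrightarrow> x \<in> carrier A \<Longrightarrow> f (r \<odot>\<^bsub>A\<^esub> x) = r \<odot>\<^bsub>B\<^esub> f x"
  shows "f \<in> mod_hom R A B"
  using assms by (auto simp: mod_hom_def hom_def)

lemma mod_homD:
  assumes "f \<in> mod_hom R A B"
  shows "x \<in> carrier A \<Longrightarrow> f x \<in> carrier B"
    and "x \<in> carrier A \<Longrightarrow> y \<in> carrier A \<Longrightarrow> f (x \<oplus>\<^bsub>A\<^esub> y) = f x \<oplus>\<^bsub>B\<^esub> f y"
    and "r \<in> carrier R \<Longrightarrow> x \<in> carrier A \<Longrightarrow> f (r \<odot>\<^bsub>A\<^esub> x) = r \<odot>\<^bsub>B\<^esub> f x"
  using assms by (auto simp: mod_hom_def hom_def)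

lemma mod_hom_zero:
  assumes "module R A" "module R B" "f \<in> mod_hom R A B"
  shows "f \<zero>\<^bsub>A\<^esub> = \<zero>\<^bsub>B\<^esub>"
proof -
  interpret A: module R A by fact
  interpret B: module R B by fact
  have "f (\<zero>\<^bsub>R\<^esub> \<odot>\<^bsub>A\<^esub> \<zero>\<^bsub>A\<^esub>) = \<zero>\<^bsub>R\<^esub> \<odot>\<^bsub>B\<^esub> f \<zero>\<^bsub>A\<^esub>"
    using assms(3) by (intro mod_homD(3)) auto
  then show ?thesis
    using mod_homD(1)[OF assms(3), of "\<zero>\<^bsub>A\<^esub>"] by simp
qed

lemma mod_hom_minus:
  assumes "module R A" "module R B" "f \<in> mod_hom R A B" "x \<in> carrier A"
  shows "f (\<ominus>\<^bsub>A\<^esub> x) = \<ominus>\<^bsub>B\<^esub> f x"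
proof -
  interpret A: module R A by fact
  interpret B: module R B by fact
  have "f (\<ominus>\<^bsub>A\<^esub> x) \<oplus>\<^bsub>B\<^esub> f x = \<zero>\<^bsub>B\<^esub>"
    using mod_homD(2)[OF assms(3), of "\<ominus>\<^bsub>A\<^esub> x" x] mod_hom_zero[OF assms(1-3)] assms(4)
    by (simp add: A.l_neg)
  then show ?thesis
    using mod_homD(1)[OF assms(3)] assms(4) by (simp add: B.minus_equality)
qed

lemma mod_hom_diff:
  assumes "module R A" "module R B" "f \<in> mod_hom R A B" "x \<in> carrier A" "y \<in> carrier A"
  shows "f (x \<ominus>\<^bsub>A\<^esub> y) = f x \<ominus>\<^bsub>B\<^esub> f y"
proof -
  interpret A: module R A by fact
  show ?thesis
  using assms mod_homD(2)[OF assms(3), of x "\<ominus>\<^bsub>A\<^esub> y"]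
  by (simp add: a_minus_def mod_hom_minus)
qed

lemma mod_hom_smult:
  assumes "module R A" "r \<in> carrier R"
  shows "(\<lambda>x. r \<odot>\<^bsub>A\<^esub> x) \<in> mod_hom R A A"
proof -
  interpret A: module R A by fact
  show ?thesis
  proof (rule mod_homI)
    fix s x assume "s \<in> carrier R" "x \<in> carrier A"
    then show "r \<odot>\<^bsub>A\<^esub> (s \<odot>\<^bsub>A\<^esub> x) = s \<odot>\<^bsub>A\<^esub> (r \<odot>\<^bsub>A\<^esub> x)"
      using assms(2) A.R.m_comm[of r s] by (simp flip: A.smult_assoc1)
  qed (use assms in \<open>auto simp: A.smult_r_distr\<close>)
qed

lemma mod_hom_id: "id \<in> mod_hom R A A"
  by (rule mod_homI) auto

lemma mod_hom_comp:
  "f \<in> mod_hom R A B \<Longrightarrow> g \<in> mod_hom R B C \<Longrightarrow> g \<circ> f \<in> mod_hom R A C"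
  by (rule mod_homI) (auto simp: mod_homD)

lemma mod_hom_image_submodule:
  assumes "module R A" "module R B" "f \<in> mod_hom R A B"
  shows "submodule (f ` carrier A) R B"
proof -
  interpret A: module R A by fact
  interpret B: module R B by fact
  show ?thesis
  proof (rule B.submoduleI)
    show "\<zero>\<^bsub>B\<^esub> \<in> f ` carrier A"
      using mod_hom_zero[OF assms] by (metis A.zero_closed imageI)
    show "\<ominus>\<^bsub>B\<^esub> a \<in> f ` carrier A" if "a \<in> f ` carrier A" for a
      using that by (auto simp flip: mod_hom_minus[OF assms])
    show "a \<oplus>\<^bsub>B\<^esub> b \<in> f ` carrier A" if "a \<in> f ` carrier A" "b \<in> f ` carrier A" for a b
      using that by (auto simp flip: mod_homD(2)[OF assms(3)])
    show "a \<odot>\<^bsub>B\<^esub> x \<in> f ` carrier A" if "a \<in> carrier R" "x \<in> f ` carrier A" for a x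
      using that by (auto simp flip: mod_homD(3)[OF assms(3)])
  qed (use mod_homD(1)[OF assms(3)] in auto)
qed

lemma image_module:
  assumes "module R A" and c: "carrier B = f ` carrier A" and z: "\<zero>\<^bsub>B\<^esub> = f \<zero>\<^bsub>A\<^esub>"
    and add: "\<And>x y. x \<in> carrier A \<Longrightarrow> y \<in> carrier A \<Longrightarrow> f x \<oplus>\<^bsub>B\<^esub> f y = f (x \<oplus>\<^bsub>A\<^esub> y)"
    and sm: "\<And>r x. r \<in> carrier R \<Longrightarrow> x \<in> carrier A \<Longrightarrow> r \<odot>\<^bsub>B\<^esub> f x = f (r \<odot>\<^bsub>A\<^esub> x)"
  shows "module R B" and "f \<in> mod_hom R A B"
proof -
  interpret A: module R A by fact
  have "abelian_group B"
  proof (rule abelian_groupI)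
    fix x assume "x \<in> carrier B"
    then obtain a where "a \<in> carrier A" "x = f a" by (auto simp: c)
    then have "f (\<ominus>\<^bsub>A\<^esub> a) \<in> carrier B \<and> f (\<ominus>\<^bsub>A\<^esub> a) \<oplus>\<^bsub>B\<^esub> x = \<zero>\<^bsub>B\<^esub>"
      by (simp add: c z add A.l_neg)
    then show "\<exists>y\<in>carrier B. y \<oplus>\<^bsub>B\<^esub> x = \<zero>\<^bsub>B\<^esub>" by blast
  qed (auto simp: c z add A.a_ac)
  then show "module R B"
    by (intro moduleI A.is_cring)
       (auto simp: c z add sm A.smult_l_distr A.smult_r_distr A.smult_assoc1)
  show "f \<in> mod_hom R A B"
    by (rule mod_homI) (auto simp: c add sm)
qed

text \<open>The quotient of \<open>A\<close> by \<open>N\<close>, carried by any set of labels \<open>q ` carrier A\<close> of the cosets.\<close>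

lemma quotient_module_exists:
  fixes q :: "'a \<Rightarrow> 'u"
  assumes "module R A" "submodule N R A"
    and q: "\<And>x y. x \<in> carrier A \<Longrightarrow> y \<in> carrier A \<Longrightarrow> q x = q y \<longleftrightarrow> x \<ominus>\<^bsub>A\<^esub> y \<in> N"
  obtains B :: "('r, 'u) module" where "module R B" "carrier B = q ` carrier A" "q \<in> mod_hom R A B"
    "\<And>x. x \<in> carrier A \<Longrightarrow> q x = \<zero>\<^bsub>B\<^esub> \<longleftrightarrow> x \<in> N"
proof -
  interpret A: module R A by fact
  note N = A.submoduleE[OF assms(2)]
  define s where "s = inv_into (carrier A) q"
  have s: "s (q x) \<in> carrier A" "q (s (q x)) = q x" if "x \<in> carrier A" for x
    using that by (auto simp: s_def inv_into_into f_inv_into_f)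
  then have sN: "s (q x) \<ominus>\<^bsub>A\<^esub> x \<in> N" if "x \<in> carrier A" for x
    using that q by blast
  define B :: "('r, 'u) module" where
    "B = \<lparr>carrier = q ` carrier A, monoid.mult = (\<lambda>_ _. undefined), one = undefined, zero = q \<zero>\<^bsub>A\<^esub>,
       add = (\<lambda>u v. q (s u \<oplus>\<^bsub>A\<^esub> s v)), smult = (\<lambda>r u. q (r \<odot>\<^bsub>A\<^esub> s u))\<rparr>"
  have B: "carrier B = q ` carrier A" "\<zero>\<^bsub>B\<^esub> = q \<zero>\<^bsub>A\<^esub>" by (auto simp: B_def)
  have add: "q x \<oplus>\<^bsub>B\<^esub> q y = q (x \<oplus>\<^bsub>A\<^esub> y)" if "x \<in> carrier A" "y \<in> carrier A" for x y
  proof -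
    have "(s (q x) \<oplus>\<^bsub>A\<^esub> s (q y)) \<ominus>\<^bsub>A\<^esub> (x \<oplus>\<^bsub>A\<^esub> y) = (s (q x) \<ominus>\<^bsub>A\<^esub> x) \<oplus>\<^bsub>A\<^esub> (s (q y) \<ominus>\<^bsub>A\<^esub> y)"
      using that s by (simp add: a_minus_def A.minus_add A.a_ac)
    then have "(s (q x) \<oplus>\<^bsub>A\<^esub> s (q y)) \<ominus>\<^bsub>A\<^esub> (x \<oplus>\<^bsub>A\<^esub> y) \<in> N"
      using N(5)[OF sN sN] that by simp
    then show ?thesis
      using q[of "s (q x) \<oplus>\<^bsub>A\<^esub> s (q y)" "x \<oplus>\<^bsub>A\<^esub> y"] that s by (simp add: B_def)
  qed
  have sm: "r \<odot>\<^bsub>B\<^esub> q x = q (r \<odot>\<^bsub>A\<^esub> x)" if "r \<in> carrier R" "x \<in> carrier A" for r x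
  proof -
    have "(r \<odot>\<^bsub>A\<^esub> s (q x)) \<ominus>\<^bsub>A\<^esub> (r \<odot>\<^bsub>A\<^esub> x) = r \<odot>\<^bsub>A\<^esub> (s (q x) \<ominus>\<^bsub>A\<^esub> x)"
      using that s by (simp add: a_minus_def A.smult_r_distr A.smult_r_minus)
    then have "(r \<odot>\<^bsub>A\<^esub> s (q x)) \<ominus>\<^bsub>A\<^esub> (r \<odot>\<^bsub>A\<^esub> x) \<in> N"
      using N(4)[OF _ sN] that by simp
    then show ?thesis
      using q[of "r \<odot>\<^bsub>A\<^esub> s (q x)" "r \<odot>\<^bsub>A\<^esub> x"] that s by (simp add: B_def)
  qed
  have z: "q x = \<zero>\<^bsub>B\<^esub> \<longleftrightarrow> x \<in> N" if "x \<in> carrier A" for x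
    using q[of x "\<zero>\<^bsub>A\<^esub>"] that A.minus_equality[of "\<zero>\<^bsub>A\<^esub>" "\<zero>\<^bsub>A\<^esub>"] by (simp add: B A.minus_eq)
  show thesis
    by (rule that[OF _ B(1) _ z])
       (use image_module[OF assms(1) B add sm] in auto)
qed

lemma submodule_zero:
  assumes "module R A" shows "submodule {\<zero>\<^bsub>A\<^esub>} R A"
proof -
  interpret A: module R A by fact
  show ?thesis
    by (rule A.submoduleI) (auto intro: A.minus_equality)
qed

lemma submodule_zero_mem: "submodule N R A \<Longrightarrow> \<zero>\<^bsub>A\<^esub> \<in> N"
  using subgroup.one_closed[OF submodule.axioms(1)] by fastforce

lemma submodule_Int:
  assumes "module R A" "submodule M R A" "submodule N R A"
  shows "submodule (M \<inter> N) R A"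
proof -
  interpret A: module R A by fact
  show ?thesis
    by (rule A.submoduleI)
       (use A.submoduleE[OF assms(2)] A.submoduleE[OF assms(3)] assms(2,3) in \<open>auto intro: submodule_zero_mem\<close>)
qed

lemma submodule_vimage:
  assumes "module R A" "module R B" "f \<in> mod_hom R A B" "submodule N R B"
  shows "submodule {x \<in> carrier A. f x \<in> N} R A"
proof -
  interpret A: module R A by fact
  interpret B: module R B by fact
  have "\<zero>\<^bsub>B\<^esub> \<in> N" using subgroup.one_closed[OF submodule.axioms(1)[OF assms(4)]] by simp
  then show ?thesis
    by (intro A.submoduleI)
       (use B.submoduleE[OF assms(4)] mod_homD[OF assms(3)] mod_hom_zero[OF assms(1-3)]
         mod_hom_minus[OF assms(1-3)] in auto)
qed

lemma iso_copy_exists: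
  fixes e :: "'a \<Rightarrow> 'u"
  assumes "module R A" "inj_on e (carrier A)"
  obtains B :: "('r, 'u) module" and d where "module R B" "e \<in> mod_hom R A B" "d \<in> mod_hom R B A"
    "\<And>x. x \<in> carrier A \<Longrightarrow> d (e x) = x" "\<And>y. y \<in> carrier B \<Longrightarrow> e (d y) = y"
proof -
  interpret A: module R A by fact
  have "e x = e y \<longleftrightarrow> x \<ominus>\<^bsub>A\<^esub> y \<in> {\<zero>\<^bsub>A\<^esub>}" if "x \<in> carrier A" "y \<in> carrier A" for x y
  proof -
    have "x \<ominus>\<^bsub>A\<^esub> y \<oplus>\<^bsub>A\<^esub> y = x"
      using that by (simp add: A.minus_eq A.a_assoc A.l_neg)
    then have "x \<ominus>\<^bsub>A\<^esub> y = \<zero>\<^bsub>A\<^esub> \<longleftrightarrow> x = y"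
      using that by (auto simp: A.minus_eq A.r_neg)
    then show ?thesis
      using that inj_on_eq_iff[OF assms(2)] by simp
  qed
  from quotient_module_exists[OF assms(1) submodule_zero[OF assms(1)] this]
  obtain B :: "('r, 'u) module" where B: "module R B" "carrier B = e ` carrier A" "e \<in> mod_hom R A B"
    by metis
  define d where "d = inv_into (carrier A) e"
  have de: "d (e x) = x" if "x \<in> carrier A" for x
    using that assms(2) by (simp add: d_def)
  show thesis
  proof (rule that[OF B(1,3) _ de])
    show "d \<in> mod_hom R B A"
    proof (rule mod_homI)
      fix r u v assume u: "u \<in> carrier B" 
      then show "d u \<in> carrier A" by (auto simp: B de)
      show "d (u \<oplus>\<^bsub>B\<^esub> v) = d u \<oplus>\<^bsub>A\<^esub> d v" if "v \<in> carrier B" using u that 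
        by (auto simp: B de simp flip: mod_homD(2)[OF B(3)])
      show "d (r \<odot>\<^bsub>B\<^esub> u) = r \<odot>\<^bsub>A\<^esub> d u" if "r \<in> carrier R" using u that 
        by (auto simp: B de simp flip: mod_homD(3)[OF B(3)])
    qed
    show "e (d y) = y" if "y \<in> carrier B" for y using that by (auto simp: B de)
  qed
qed

text \<open>Finitely generated submodules have carriers that embed into \<open>'r list\<close>.\<close>

lemma small_submodule_exists:
  fixes R :: "('r, 'x) ring_scheme" and A :: "('r, 'a, 'y) module_scheme"
  assumes "module R A" "finite S" "S \<subseteq> carrier A"
  shows "\<exists>N e. submodule N R A \<and> S \<subseteq> N \<and> inj_on (e :: 'a \<Rightarrow> 'r list) N"
  using assms(2,3)
proof (induction rule: finite_induct)
  case empty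
  have "inj_on (\<lambda>_. [] :: 'r list) {\<zero>\<^bsub>A\<^esub>}" by simp
  then show ?case using submodule_zero[OF assms(1)] by blast
next
  case (insert s S)
  interpret A: module R A by fact
  from insert obtain N and e :: "'a \<Rightarrow> 'r list"
    where N: "submodule N R A" "S \<subseteq> N" "inj_on e N" by blast
  have s: "s \<in> carrier A" using insert by simp
  note NE = A.submoduleE[OF N(1)]
  have N0: "\<zero>\<^bsub>A\<^esub> \<in> N" using subgroup.one_closed[OF submodule.axioms(1)[OF N(1)]] by simp
  define N' where "N' = {r \<odot>\<^bsub>A\<^esub> s \<oplus>\<^bsub>A\<^esub> y | r y. r \<in> carrier R \<and> y \<in> N}"
  have Nc: "y \<in> carrier A" if "y \<in> N" for y using that NE(1) by auto
  have N'I: "z \<in> N'" if "r \<in> carrier R" "y \<in> N" "z = r \<odot>\<^bsub>A\<^esub> s \<oplus>\<^bsub>A\<^esub> y" for r y z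
    using that by (auto simp: N'_def)
  have "submodule N' R A"
  proof (rule A.submoduleI)
    show "N' \<subseteq> carrier A" using s Nc by (auto simp: N'_def)
    show "\<zero>\<^bsub>A\<^esub> \<in> N'" using N0 s by (intro N'I[of "\<zero>\<^bsub>R\<^esub>" "\<zero>\<^bsub>A\<^esub>"]) auto
    show "\<ominus>\<^bsub>A\<^esub> a \<in> N'" if a: "a \<in> N'" for a
    proof -
      obtain r y where ry: "r \<in> carrier R" "y \<in> N" "a = r \<odot>\<^bsub>A\<^esub> s \<oplus>\<^bsub>A\<^esub> y" using a by (auto simp: N'_def)
      then show ?thesis using NE(3) s Nc
        by (intro N'I[of "\<ominus>\<^bsub>R\<^esub> r" "\<ominus>\<^bsub>A\<^esub> y"]) (auto simp: A.minus_add A.smult_l_minus)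
    qed
    show "a \<oplus>\<^bsub>A\<^esub> b \<in> N'" if a: "a \<in> N'" "b \<in> N'" for a b
    proof -
      obtain r y where ry: "r \<in> carrier R" "y \<in> N" "a = r \<odot>\<^bsub>A\<^esub> s \<oplus>\<^bsub>A\<^esub> y" using a by (auto simp: N'_def)
      obtain t x where tx: "t \<in> carrier R" "x \<in> N" "b = t \<odot>\<^bsub>A\<^esub> s \<oplus>\<^bsub>A\<^esub> x" using a by (auto simp: N'_def)
      show ?thesis using NE(5) s Nc ry tx
        by (intro N'I[of "r \<oplus>\<^bsub>R\<^esub> t" "y \<oplus>\<^bsub>A\<^esub> x"]) (auto simp: A.smult_l_distr A.a_ac)
    qed
    show "a \<odot>\<^bsub>A\<^esub> x \<in> N'" if a: "a \<in> carrier R" "x \<in> N'" for a x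
    proof -
      obtain r y where ry: "r \<in> carrier R" "y \<in> N" "x = r \<odot>\<^bsub>A\<^esub> s \<oplus>\<^bsub>A\<^esub> y" using a by (auto simp: N'_def)
      then show ?thesis using NE(4) s Nc a
        by (intro N'I[of "a \<otimes>\<^bsub>R\<^esub> r" "a \<odot>\<^bsub>A\<^esub> y"]) (auto simp: A.smult_r_distr A.smult_assoc1)
    qed
  qed
  moreover have "insert s S \<subseteq> N'"
  proof
    fix x assume "x \<in> insert s S"
    then show "x \<in> N'"
      using N0 s N(2) Nc N'I[of "\<one>\<^bsub>R\<^esub>" "\<zero>\<^bsub>A\<^esub>" x] N'I[of "\<zero>\<^bsub>R\<^esub>" x x] by auto
  qed
  moreover have "\<exists>e' :: 'a \<Rightarrow> 'r list. inj_on e' N'"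
  proof -
    define rep where "rep = (\<lambda>z. SOME p. fst p \<in> carrier R \<and> snd p \<in> N \<and> z = fst p \<odot>\<^bsub>A\<^esub> s \<oplus>\<^bsub>A\<^esub> snd p)"
    have rep: "fst (rep z) \<in> carrier R \<and> snd (rep z) \<in> N \<and> z = fst (rep z) \<odot>\<^bsub>A\<^esub> s \<oplus>\<^bsub>A\<^esub> snd (rep z)"
      if "z \<in> N'" for z
    proof -
      have "\<exists>p. fst p \<in> carrier R \<and> snd p \<in> N \<and> z = fst p \<odot>\<^bsub>A\<^esub> s \<oplus>\<^bsub>A\<^esub> snd p"
        using that by (auto simp: N'_def)
      from someI_ex[OF this] show ?thesis by (simp add: rep_def)
    qed
    have "inj_on (\<lambda>z. fst (rep z) # e (snd (rep z))) N'"
    proof (rule inj_onI)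
      fix x y assume xy: "x \<in> N'" "y \<in> N'" "fst (rep x) # e (snd (rep x)) = fst (rep y) # e (snd (rep y))"
      then have "rep x = rep y"
        using rep[OF xy(1)] rep[OF xy(2)] N(3) by (auto simp: prod_eq_iff dest: inj_onD)
      then show "x = y" using rep[OF xy(1)] rep[OF xy(2)] by simp
    qed
    then show ?thesis by blast
  qed
  ultimately show ?case by blast
qed

theorem um_ringD:
  fixes R :: "('r, 'x) ring_scheme" and M :: "('r, 'm, 'y) module_scheme"
  assumes "um_ring R" and "module R M" and "finite \<N>" "\<And>N. N \<in> \<N> \<Longrightarrow> submodule N R M" "carrier M = \<Union>\<N>"
  shows "carrier M \<in> \<N>"
proof (rule ccontr)
  assume neg: "carrier M \<notin> \<N>"
  interpret M: module R M by (rule assms(2))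
  have "\<exists>m. m \<in> carrier M \<and> m \<notin> N" if N: "N \<in> \<N>" for N
  proof -
    have "N \<subseteq> carrier M" "N \<noteq> carrier M" using M.submoduleE(1)[OF assms(4)[OF N]] neg N by auto
    then show ?thesis by auto
  qed
  then obtain p where p: "\<And>N. N \<in> \<N> \<Longrightarrow> p N \<in> carrier M \<and> p N \<notin> N" by metis
  obtain L and e :: "'m \<Rightarrow> 'r list" where L: "submodule L R M" "p ` \<N> \<subseteq> L" "inj_on e L"
  proof -
    have "finite (p ` \<N>)" "p ` \<N> \<subseteq> carrier M" using p assms(3) by auto
    from small_submodule_exists[OF assms(2) this] that show ?thesis by auto
  qed
  note LM = submodule.submodule_is_module[OF L(1) assms(2)]
  have "inj_on e (carrier (M\<lparr>carrier := L\<rparr>))" using L(3) by simp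
  from iso_copy_exists[OF LM this]
  obtain B :: "('r, 'r list) module" and d where B: "module R B" "e \<in> mod_hom R (M\<lparr>carrier := L\<rparr>) B"
      "d \<in> mod_hom R B (M\<lparr>carrier := L\<rparr>)" "\<And>x. x \<in> carrier (M\<lparr>carrier := L\<rparr>) \<Longrightarrow> d (e x) = x"
    by metis
  have dM: "d \<in> mod_hom R B M"
    using mod_homD[OF B(3)] M.submoduleE(1)[OF L(1)] by (intro mod_homI) auto
  define P where "P = (\<lambda>N. {y \<in> carrier B. d y \<in> N})"
  have "carrier B \<in> P ` \<N>"
  proof -
    have "\<forall>N\<in>P ` \<N>. submodule N R B"
      using submodule_vimage[OF B(1) assms(2) dM] assms(4) by (auto simp: P_def)
    moreover have "carrier B = \<Union>(P ` \<N>)"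
      using mod_homD(1)[OF dM] assms(5) by (auto simp: P_def)
    ultimately show ?thesis
      using assms(1,3) B(1) unfolding um_ring_def by blast
  qed
  then obtain N where N: "N \<in> \<N>" "carrier B = P N" by auto
  have "e (p N) \<in> carrier B" using mod_homD(1)[OF B(2), of "p N"] L(2) N by auto
  then have "e (p N) \<in> P N" using N(2) by (rule subst[rotated])
  then have "d (e (p N)) \<in> N" unfolding P_def by blast
  moreover have "d (e (p N)) = p N" using B(4)[of "p N"] L(2) N(1) by auto
  ultimately have "p N \<in> N" by simp
  then show False using p[OF N(1)] by simp
qed

lemma carrier_tensor_free [simp]: "c \<in> carrier (tensor_free F M) \<longleftrightarrow> Poly_Mapping.keys c \<subseteq> carrier F \<times> carrier M"
  by (simp add: tensor_free_def)

lemma tensor_free_simps [simp]: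
  "\<one>\<^bsub>tensor_free F M\<^esub> = 0" "c \<otimes>\<^bsub>tensor_free F M\<^esub> d = c + d"
  by (simp_all add: tensor_free_def)

lemma tensor_rel_cases [consumes 1, case_names add_left add_right smult]:
  assumes "c \<in> tensor_rel R F M"
  obtains x x' m where "c = frag_of (x \<oplus>\<^bsub>F\<^esub> x', m) - frag_of (x, m) - frag_of (x', m)"
      "x \<in> carrier F" "x' \<in> carrier F" "m \<in> carrier M"
  | x m m' where "c = frag_of (x, m \<oplus>\<^bsub>M\<^esub> m') - frag_of (x, m) - frag_of (x, m')"
      "x \<in> carrier F" "m \<in> carrier M" "m' \<in> carrier M"
  | r x m where "c = frag_of (r \<odot>\<^bsub>F\<^esub> x, m) - frag_of (x, r \<odot>\<^bsub>M\<^esub> m)"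
      "r \<in> carrier R" "x \<in> carrier F" "m \<in> carrier M"
  using assms unfolding tensor_rel_def by blast

lemma keys_diff_subset:
  fixes c d :: "'a \<Rightarrow>\<^sub>0 int"
  shows "Poly_Mapping.keys c \<subseteq> S \<Longrightarrow> Poly_Mapping.keys d \<subseteq> S \<Longrightarrow> Poly_Mapping.keys (c - d) \<subseteq> S"
  using keys_diff[of c d] by blast

lemma tensor_rel_keys:
  assumes "module R F" "module R M" "c \<in> tensor_rel R F M"
  shows "Poly_Mapping.keys c \<subseteq> carrier F \<times> carrier M"
proof -
  interpret F: module R F by fact
  interpret M: module R M by fact
  show ?thesis
    using assms(3) unfolding tensor_rel_def by (elim UnE CollectE exE conjE) (simp_all add: keys_diff_subset)
qed

lemma tensor_ker_subgroup:
  assumes "module R F" "module R M"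
  shows "subgroup (tensor_ker R F M) (tensor_free F M)"
  unfolding tensor_ker_def
  by (rule group.generate_is_subgroup)
     (use tensor_rel_keys[OF assms] in \<open>auto simp: tensor_free_def\<close>)

lemma tensor_ker_keys:
  assumes "module R F" "module R M" "c \<in> tensor_ker R F M"
  shows "Poly_Mapping.keys c \<subseteq> carrier F \<times> carrier M"
  using subgroup.mem_carrier[OF tensor_ker_subgroup[OF assms(1,2)] assms(3)] by simp

lemma tensor_ker_zero: "0 \<in> tensor_ker R F M"
  using generate.one[of "tensor_free F M"] by (simp add: tensor_ker_def)

lemma tensor_ker_rel: "c \<in> tensor_rel R F M \<Longrightarrow> c \<in> tensor_ker R F M"
  unfolding tensor_ker_def by (rule generate.incl)

lemma tensor_ker_add: "c \<in> tensor_ker R F M \<Longrightarrow> d \<in> tensor_ker R F M \<Longrightarrow> c + d \<in> tensor_ker R F M"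
  unfolding tensor_ker_def using generate.eng[of c "tensor_free F M"] by simp

lemma tensor_ker_minus:
  assumes "module R F" "module R M" "c \<in> tensor_ker R F M"
  shows "- c \<in> tensor_ker R F M"
  using subgroup.m_inv_closed[OF tensor_ker_subgroup[OF assms(1,2)] assms(3)]
    tensor_ker_keys[OF assms] by (simp add: tensor_free_def)

lemma tensor_ker_diff:
  assumes "module R F" "module R M" "c \<in> tensor_ker R F M" "d \<in> tensor_ker R F M"
  shows "c - d \<in> tensor_ker R F M"
  using tensor_ker_add[OF assms(3) tensor_ker_minus[OF assms(1,2,4)]] by simp

lemma tensor_ker_induct [consumes 3, case_names zero rel diff]:
  assumes F: "module R F" and M: "module R M" and c: "c \<in> tensor_ker R F M"
    and zero: "P 0" and rel: "\<And>c. c \<in> tensor_rel R F M \<Longrightarrow> P c"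
    and diff: "\<And>c d. c \<in> tensor_ker R F M \<Longrightarrow> d \<in> tensor_ker R F M \<Longrightarrow> P c \<Longrightarrow> P d \<Longrightarrow> P (c - d)"
  shows "P c"
proof -
  have "c \<in> tensor_ker R F M \<and> P c"
    using c unfolding tensor_ker_def
  proof (induction rule: generate.induct)
    case one
    then show ?case using zero generate.one[of "tensor_free F M"] by simp
  next
    case (incl h)
    then show ?case using rel generate.incl by metis
  next
    case (inv h)
    have h: "inv\<^bsub>tensor_free F M\<^esub> h = 0 - h"
      using tensor_rel_keys[OF F M inv] by (simp add: tensor_free_def)
    then show ?case
      using diff[OF tensor_ker_zero tensor_ker_rel[OF inv] zero rel[OF inv]]
        generate.inv[OF inv, of "tensor_free F M"] by simp
  next
    case (eng h k)
    then have k: "h \<in> tensor_ker R F M" "k \<in> tensor_ker R F M" "P h" "P k" by (auto simp: tensor_ker_def)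
    have "P (0 - k)" "- k \<in> tensor_ker R F M"
      using diff[OF tensor_ker_zero k(2) zero k(4)] tensor_ker_minus[OF F M k(2)] by auto
    then have "P (h - (0 - k))"
      using diff[OF k(1) _ k(3), of "0 - k"] by simp
    then show ?case using tensor_ker_add[OF k(1,2)] by (simp add: tensor_ker_def)
  qed
  then show ?thesis ..
qed

lemma tensor_push_simps [simp]:
  "tensor_push g f 0 = 0"
  "tensor_push g f (frag_of (x, a)) = frag_of (g x, f a)"
  "tensor_push g f (c + d) = tensor_push g f c + tensor_push g f d"
  "tensor_push g f (c - d) = tensor_push g f c - tensor_push g f d"
  by (simp_all add: tensor_push_def frag_extend_add frag_extend_diff)

lemma tensor_push_keys:
  assumes "Poly_Mapping.keys c \<subseteq> X \<times> A" "g ` X \<subseteq> Y" "f ` A \<subseteq> B"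
  shows "Poly_Mapping.keys (tensor_push g f c) \<subseteq> Y \<times> B"
proof -
  have "Poly_Mapping.keys (tensor_push g f c) \<subseteq> (\<lambda>(x, a). (g x, f a)) ` Poly_Mapping.keys c"
    using keys_frag_extend[of "\<lambda>(x, a). frag_of (g x, f a)" c]
    by (auto simp: tensor_push_def case_prod_beta)
  also have "\<dots> \<subseteq> Y \<times> B" using assms by auto
  finally show ?thesis .
qed

lemma tensor_push_cong:
  assumes "Poly_Mapping.keys c \<subseteq> X \<times> A" "\<And>x. x \<in> X \<Longrightarrow> g x = g' x" "\<And>a. a \<in> A \<Longrightarrow> f a = f' a"
  shows "tensor_push g f c = tensor_push g' f' c"
  unfolding tensor_push_def by (rule frag_extend_eq) (use assms in auto)

lemma tensor_push_comp: "tensor_push g f (tensor_push g' f' c) = tensor_push (g \<circ> g') (f \<circ> f') c"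
proof -
  have *: "(\<lambda>(x, a). frag_of (g' x, f' a)) = frag_of \<circ> (\<lambda>(x, a). (g' x, f' a))" by auto
  show ?thesis
    unfolding tensor_push_def * frag_extend_compose by (rule frag_extend_eq) auto
qed

lemma tensor_push_id: "tensor_push id id c = c"
proof -
  have "tensor_push id id c = frag_extend frag_of c"
    unfolding tensor_push_def by (rule frag_extend_eq) auto
  also have "\<dots> = c" by (rule frag_expansion[symmetric])
  finally show ?thesis .
qed

lemma tensor_push_ker:
  assumes F: "module R F" and A: "module R A"
    and g: "g \<in> mod_hom R F G" and f: "f \<in> mod_hom R A B" and B: "module R G" "module R B"
    and c: "c \<in> tensor_ker R F A"
  shows "tensor_push g f c \<in> tensor_ker R G B"
  using F A c
proof (induction rule: tensor_ker_induct)
  case zero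
  then show ?case by (simp add: tensor_ker_zero)
next
  case (rel c)
  note h = mod_homD[OF g] mod_homD[OF f]
  interpret F: module R F by fact
  interpret A: module R A by fact
  from rel have "tensor_push g f c \<in> tensor_rel R G B"
  proof (cases rule: tensor_rel_cases)
    fix x x' m assume *: "c = frag_of (x \<oplus>\<^bsub>F\<^esub> x', m) - frag_of (x, m) - frag_of (x', m)"
      "x \<in> carrier F" "x' \<in> carrier F" "m \<in> carrier A"
    then have "tensor_push g f c =
        frag_of (g x \<oplus>\<^bsub>G\<^esub> g x', f m) - frag_of (g x, f m) - frag_of (g x', f m)"
      by (simp add: h)
    then show "tensor_push g f c \<in> tensor_rel R G B" using h * unfolding tensor_rel_def by blast
  next
    fix x m m' assume *: "c = frag_of (x, m \<oplus>\<^bsub>A\<^esub> m') - frag_of (x, m) - frag_of (x, m')"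
      "x \<in> carrier F" "m \<in> carrier A" "m' \<in> carrier A"
    then have "tensor_push g f c =
        frag_of (g x, f m \<oplus>\<^bsub>B\<^esub> f m') - frag_of (g x, f m) - frag_of (g x, f m')"
      by (simp add: h)
    then show "tensor_push g f c \<in> tensor_rel R G B" using h * unfolding tensor_rel_def by blast
  next
    fix r x m assume *: "c = frag_of (r \<odot>\<^bsub>F\<^esub> x, m) - frag_of (x, r \<odot>\<^bsub>A\<^esub> m)"
      "r \<in> carrier R" "x \<in> carrier F" "m \<in> carrier A"
    then have "tensor_push g f c = frag_of (r \<odot>\<^bsub>G\<^esub> g x, f m) - frag_of (g x, r \<odot>\<^bsub>B\<^esub> f m)"
      by (simp add: h)
    then show "tensor_push g f c \<in> tensor_rel R G B" using h * unfolding tensor_rel_def by blast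
  qed
  then show ?case by (rule tensor_ker_rel)
next
  case (diff c d)
  then show ?case using tensor_ker_diff[OF B] by simp
qed

lemma tensor_ker_finite_support:
  assumes F: "module R F" and M: "module R M" and c: "c \<in> tensor_ker R F M"
  obtains S where "finite S" "S \<subseteq> carrier M"
    "\<And>N. submodule N R M \<Longrightarrow> S \<subseteq> N \<Longrightarrow> c \<in> tensor_ker R F (M\<lparr>carrier := N\<rparr>)"
proof -
  have "\<exists>S. finite S \<and> S \<subseteq> carrier M \<and> (\<forall>N. submodule N R M \<longrightarrow> S \<subseteq> N \<longrightarrow> c \<in> tensor_ker R F (M\<lparr>carrier := N\<rparr>))"
    using F M c
  proof (induction rule: tensor_ker_induct)
    case zero
    then show ?case by (auto intro: tensor_ker_zero)
  next
    case (rel c)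
    then have "\<exists>S. finite S \<and> S \<subseteq> carrier M \<and> (\<forall>N. S \<subseteq> N \<longrightarrow> c \<in> tensor_rel R F (M\<lparr>carrier := N\<rparr>))" (is ?E)
    proof (cases rule: tensor_rel_cases)
      fix x x' m assume "c = frag_of (x \<oplus>\<^bsub>F\<^esub> x', m) - frag_of (x, m) - frag_of (x', m)"
        "x \<in> carrier F" "x' \<in> carrier F" "m \<in> carrier M"
      then show ?E unfolding tensor_rel_def by (intro exI[of _ "{m}"]) auto
    next
      fix x m m' assume "c = frag_of (x, m \<oplus>\<^bsub>M\<^esub> m') - frag_of (x, m) - frag_of (x, m')"
        "x \<in> carrier F" "m \<in> carrier M" "m' \<in> carrier M"
      then show ?E unfolding tensor_rel_def by (intro exI[of _ "{m, m'}"]) auto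
    next
      fix r x m assume "c = frag_of (r \<odot>\<^bsub>F\<^esub> x, m) - frag_of (x, r \<odot>\<^bsub>M\<^esub> m)"
        "r \<in> carrier R" "x \<in> carrier F" "m \<in> carrier M"
      then show ?E unfolding tensor_rel_def by (intro exI[of _ "{m}"]) auto
    qed
    then show ?case using tensor_ker_rel by meson
  next
    case (diff c d)
    then obtain S T where "finite S" "S \<subseteq> carrier M" "finite T" "T \<subseteq> carrier M"
      "\<And>N. submodule N R M \<Longrightarrow> S \<subseteq> N \<Longrightarrow> c \<in> tensor_ker R F (M\<lparr>carrier := N\<rparr>)"
      "\<And>N. submodule N R M \<Longrightarrow> T \<subseteq> N \<Longrightarrow> d \<in> tensor_ker R F (M\<lparr>carrier := N\<rparr>)" by blast
    then show ?case
      by (intro exI[of _ "S \<union> T"])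
         (auto intro!: tensor_ker_diff[OF F] submodule.submodule_is_module[OF _ M])
  qed
  then show thesis using that by blast
qed

lemma tensor_coset: "tensor_ker R F M #>\<^bsub>tensor_free F M\<^esub> c = (\<lambda>k. k + c) ` tensor_ker R F M"
  by (auto simp: r_coset_def)

lemma tensor_coset_eq_iff:
  assumes "module R F" "module R M"
  shows "tensor_ker R F M #>\<^bsub>tensor_free F M\<^esub> c = tensor_ker R F M #>\<^bsub>tensor_free F M\<^esub> d
    \<longleftrightarrow> c - d \<in> tensor_ker R F M" (is "?L = ?R \<longleftrightarrow> _")
proof
  assume "?L = ?R"
  moreover have "0 + c \<in> ?L" unfolding tensor_coset by (intro imageI tensor_ker_zero)
  ultimately have "c \<in> ?R" by simp
  then show "c - d \<in> tensor_ker R F M" by (auto simp: tensor_coset)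
next
  assume cd: "c - d \<in> tensor_ker R F M"
  have *: "x + a \<in> (\<lambda>k. k + b) ` tensor_ker R F M" if "x \<in> tensor_ker R F M" "a - b \<in> tensor_ker R F M"
    for x a b
    using tensor_ker_add[OF that] by (intro image_eqI[of _ _ "x + (a - b)"]) auto
  have "d - c \<in> tensor_ker R F M" using tensor_ker_minus[OF assms cd] by simp
  then show "?L = ?R" using cd * by (auto simp: tensor_coset)
qed

lemma carrier_tensor_module:
  "carrier (tensor_module R F M) =
     (\<lambda>c. tensor_ker R F M #>\<^bsub>tensor_free F M\<^esub> c) ` {c. Poly_Mapping.keys c \<subseteq> carrier F \<times> carrier M}"
  by (auto simp: tensor_module_def FactGroup_def RCOSETS_def)

lemma zero_tensor_module: "\<zero>\<^bsub>tensor_module R F M\<^esub> = tensor_ker R F M #>\<^bsub>tensor_free F M\<^esub> 0"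
  by (simp add: tensor_module_def tensor_coset)

lemma tensor_push_coset:
  assumes F: "module R F" and A: "module R A"
    and g: "g \<in> mod_hom R F G" and f: "f \<in> mod_hom R A B" and B: "module R G" "module R B"
  shows "tensor_ker R G B <#>\<^bsub>tensor_free G B\<^esub>
      tensor_push g f ` (tensor_ker R F A #>\<^bsub>tensor_free F A\<^esub> c)
    = tensor_ker R G B #>\<^bsub>tensor_free G B\<^esub> tensor_push g f c" (is "?L = ?R")
proof
  show "?L \<subseteq> ?R"
    using tensor_ker_add tensor_push_ker[OF F A g f B]
    by (fastforce simp: tensor_coset set_mult_def simp flip: add.assoc)
  have "k + tensor_push g f c \<in> ?L" if "k \<in> tensor_ker R G B" for k
    using that tensor_ker_zero[of R F A] by (force simp: tensor_coset set_mult_def)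
  then show "?R \<subseteq> ?L" by (auto simp: tensor_coset)
qed

lemma tensor_map_coset:
  assumes "module R F" "module R A" "module R B" "f \<in> mod_hom R A B"
  shows "tensor_map R F B f (tensor_ker R F A #>\<^bsub>tensor_free F A\<^esub> c) =
    tensor_ker R F B #>\<^bsub>tensor_free F B\<^esub> tensor_push id f c"
  unfolding tensor_map_def using tensor_push_coset[OF assms(1,2) mod_hom_id assms(4,1,3)] .

lemma smult_tensor_module:
  assumes "module R F" "module R M" "r \<in> carrier R"
  shows "r \<odot>\<^bsub>tensor_module R F M\<^esub> (tensor_ker R F M #>\<^bsub>tensor_free F M\<^esub> c) =
    tensor_ker R F M #>\<^bsub>tensor_free F M\<^esub> tensor_push (\<lambda>x. r \<odot>\<^bsub>F\<^esub> x) id c"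
  using tensor_push_coset[OF assms(1,2) mod_hom_smult[OF assms(1,3)] mod_hom_id assms(1,2)]
  by (simp add: tensor_module_def)

lemma add_tensor_module:
  "(tensor_ker R F M #>\<^bsub>tensor_free F M\<^esub> c) \<oplus>\<^bsub>tensor_module R F M\<^esub>
    (tensor_ker R F M #>\<^bsub>tensor_free F M\<^esub> d) = tensor_ker R F M #>\<^bsub>tensor_free F M\<^esub> (c + d)" (is "?L = ?R")
proof -
  have L: "?L = {(k + c) + (l + d) | k l. k \<in> tensor_ker R F M \<and> l \<in> tensor_ker R F M}"
    by (auto simp: tensor_module_def tensor_coset set_mult_def)
  show ?thesis
  proof
    show "?L \<subseteq> ?R"
    proof
      fix z assume "z \<in> ?L"
      then obtain k l where k: "k \<in> tensor_ker R F M" "l \<in> tensor_ker R F M" "z = (k + c) + (l + d)"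
        unfolding L by blast
      then have "z = (k + l) + (c + d)" by (simp add: algebra_simps)
      then show "z \<in> ?R" using tensor_ker_add[OF k(1,2)] by (auto simp: tensor_coset)
    qed
    show "?R \<subseteq> ?L"
    proof
      fix z assume "z \<in> ?R"
      then obtain k where k: "k \<in> tensor_ker R F M" "z = k + (c + d)" by (auto simp: tensor_coset)
      then have "z = (k + c) + (0 + d)" by (simp add: algebra_simps)
      then show "z \<in> ?L" unfolding L using k(1) tensor_ker_zero by blast
    qed
  qed
qed

lemma tensor_push_smult_add:
  assumes F: "module R F" and M: "module R M" and r: "r \<in> carrier R" "s \<in> carrier R"
    and c: "Poly_Mapping.keys c \<subseteq> carrier F \<times> carrier M"
  shows "tensor_push (\<lambda>x. (r \<oplus>\<^bsub>R\<^esub> s) \<odot>\<^bsub>F\<^esub> x) id c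
     - (tensor_push (\<lambda>x. r \<odot>\<^bsub>F\<^esub> x) id c + tensor_push (\<lambda>x. s \<odot>\<^bsub>F\<^esub> x) id c) \<in> tensor_ker R F M"
  using c
proof (induction c rule: frag_induction)
  case zero
  then show ?case by (simp add: tensor_ker_zero)
next
  case (diff x y)
  from tensor_ker_diff[OF F M diff] show ?case by (simp add: algebra_simps)
next
  case (one a)
  interpret F: module R F by fact
  from one obtain x m where a: "a = (x, m)" "x \<in> carrier F" "m \<in> carrier M" by auto
  then have "frag_of (r \<odot>\<^bsub>F\<^esub> x \<oplus>\<^bsub>F\<^esub> s \<odot>\<^bsub>F\<^esub> x, m) - frag_of (r \<odot>\<^bsub>F\<^esub> x, m) - frag_of (s \<odot>\<^bsub>F\<^esub> x, m)
      \<in> tensor_rel R F M"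
    using r F.smult_closed unfolding tensor_rel_def by blast
  then show ?case
    using tensor_ker_rel a r by (fastforce simp: F.smult_l_distr algebra_simps)
qed

theorem tensor_module_is_module:
  assumes F: "module R F" and M: "module R M"
  shows "module R (tensor_module R F M)"
proof -
  interpret F: module R F by fact
  interpret M: module R M by fact
  let ?T = "tensor_module R F M"
  let ?K = "\<lambda>c. tensor_ker R F M #>\<^bsub>tensor_free F M\<^esub> c"
  let ?S = "carrier F \<times> carrier M"
  have obt: "\<exists>c. Poly_Mapping.keys c \<subseteq> ?S \<and> X = ?K c" if "X \<in> carrier ?T" for X
    using that by (auto simp: carrier_tensor_module)
  have cl: "?K c \<in> carrier ?T" if "Poly_Mapping.keys c \<subseteq> ?S" for c
    using that by (auto simp: carrier_tensor_module)
  have kadd: "Poly_Mapping.keys (c + d) \<subseteq> ?S" if "Poly_Mapping.keys c \<subseteq> ?S" "Poly_Mapping.keys d \<subseteq> ?S" for c d :: "_ \<Rightarrow>\<^sub>0 int"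
    using that keys_add[of c d] by blast
  have kpush: "Poly_Mapping.keys (tensor_push (\<lambda>x. r \<odot>\<^bsub>F\<^esub> x) id c) \<subseteq> ?S"
    if "Poly_Mapping.keys c \<subseteq> ?S" "r \<in> carrier R" for r c
    using that by (intro tensor_push_keys[of c "carrier F" "carrier M"]) auto
  have ab: "abelian_group ?T"
  proof (rule abelian_groupI)
    fix X assume "X \<in> carrier ?T"
    then obtain c where c: "Poly_Mapping.keys c \<subseteq> ?S" "X = ?K c" using obt by blast
    then show "\<exists>Y\<in>carrier ?T. Y \<oplus>\<^bsub>?T\<^esub> X = \<zero>\<^bsub>?T\<^esub>"
      using cl[of "- c"] by (intro bexI[of _ "?K (- c)"]) (simp_all add: add_tensor_module zero_tensor_module)
    show "\<zero>\<^bsub>?T\<^esub> \<oplus>\<^bsub>?T\<^esub> X = X" using c by (simp add: add_tensor_module zero_tensor_module)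
    fix Y assume "Y \<in> carrier ?T"
    then obtain d where d: "Poly_Mapping.keys d \<subseteq> ?S" "Y = ?K d" using obt by blast
    show "X \<oplus>\<^bsub>?T\<^esub> Y \<in> carrier ?T" using c d kadd cl by (simp add: add_tensor_module)
    show "X \<oplus>\<^bsub>?T\<^esub> Y = Y \<oplus>\<^bsub>?T\<^esub> X" using c d by (simp add: add_tensor_module add.commute)
    fix Z assume "Z \<in> carrier ?T"
    then obtain e where e: "Z = ?K e" using obt by blast
    show "X \<oplus>\<^bsub>?T\<^esub> Y \<oplus>\<^bsub>?T\<^esub> Z = X \<oplus>\<^bsub>?T\<^esub> (Y \<oplus>\<^bsub>?T\<^esub> Z)"
      using c d e by (simp add: add_tensor_module add.assoc)
  next
    show "\<zero>\<^bsub>?T\<^esub> \<in> carrier ?T" unfolding zero_tensor_module by (rule cl) simp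
  qed
  note sm = smult_tensor_module[OF F M]
  show ?thesis
  proof (rule moduleI[OF F.is_cring ab])
    fix a X assume a: "a \<in> carrier R" and X: "X \<in> carrier ?T"
    from X obtain c where c: "Poly_Mapping.keys c \<subseteq> ?S" "X = ?K c" using obt by blast
    show "a \<odot>\<^bsub>?T\<^esub> X \<in> carrier ?T" using a c kpush cl by (simp add: sm)
    {
      fix Y assume "Y \<in> carrier ?T"
      then obtain d where d: "Y = ?K d" using obt by blast
      show "a \<odot>\<^bsub>?T\<^esub> (X \<oplus>\<^bsub>?T\<^esub> Y) = a \<odot>\<^bsub>?T\<^esub> X \<oplus>\<^bsub>?T\<^esub> a \<odot>\<^bsub>?T\<^esub> Y"
        using a c d by (simp add: sm add_tensor_module)
    next
      fix b assume b: "b \<in> carrier R"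
      show "(a \<oplus>\<^bsub>R\<^esub> b) \<odot>\<^bsub>?T\<^esub> X = a \<odot>\<^bsub>?T\<^esub> X \<oplus>\<^bsub>?T\<^esub> b \<odot>\<^bsub>?T\<^esub> X"
        using a b c tensor_push_smult_add[OF F M a b c(1)]
        by (simp add: sm add_tensor_module tensor_coset_eq_iff[OF F M])
      have "tensor_push (\<lambda>x. (a \<otimes>\<^bsub>R\<^esub> b) \<odot>\<^bsub>F\<^esub> x) id c
          = tensor_push (\<lambda>x. a \<odot>\<^bsub>F\<^esub> x) id (tensor_push (\<lambda>x. b \<odot>\<^bsub>F\<^esub> x) id c)"
        unfolding tensor_push_comp by (rule tensor_push_cong[OF c(1)]) (use a b F.smult_assoc1 in auto)
      then show "(a \<otimes>\<^bsub>R\<^esub> b) \<odot>\<^bsub>?T\<^esub> X = a \<odot>\<^bsub>?T\<^esub> (b \<odot>\<^bsub>?T\<^esub> X)"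
        using a b c by (simp add: sm)
    }
  next
    fix X assume X: "X \<in> carrier ?T"
    then obtain c where c: "Poly_Mapping.keys c \<subseteq> ?S" "X = ?K c" using obt by blast
    have "tensor_push (\<lambda>x. \<one>\<^bsub>R\<^esub> \<odot>\<^bsub>F\<^esub> x) id c = tensor_push id id c"
      by (rule tensor_push_cong[OF c(1)]) auto
    then show "\<one>\<^bsub>R\<^esub> \<odot>\<^bsub>?T\<^esub> X = X" using c by (simp add: sm tensor_push_id)
  qed
qed

theorem tensor_map_hom:
  assumes F: "module R F" and A: "module R A" and B: "module R B" and f: "f \<in> mod_hom R A B"
  shows "tensor_map R F B f \<in> mod_hom R (tensor_module R F A) (tensor_module R F B)"
proof -
  interpret F: module R F by fact
  show ?thesis
  proof (rule mod_homI)
    let ?K = "\<lambda>c. tensor_ker R F A #>\<^bsub>tensor_free F A\<^esub> c"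
    fix X assume "X \<in> carrier (tensor_module R F A)"
    then obtain c where c: "Poly_Mapping.keys c \<subseteq> carrier F \<times> carrier A" "X = ?K c"
      by (auto simp: carrier_tensor_module)
    have "Poly_Mapping.keys (tensor_push id f c) \<subseteq> carrier F \<times> carrier B"
      using c mod_homD(1)[OF f] by (intro tensor_push_keys[of c "carrier F" "carrier A"]) auto
    then show "tensor_map R F B f X \<in> carrier (tensor_module R F B)"
      using c by (auto simp: tensor_map_coset[OF F A B f] carrier_tensor_module)
    {
      fix Y assume "Y \<in> carrier (tensor_module R F A)"
      then obtain d where d: "Y = ?K d"
        by (auto simp: carrier_tensor_module)
      show "tensor_map R F B f (X \<oplus>\<^bsub>tensor_module R F A\<^esub> Y) =
          tensor_map R F B f X \<oplus>\<^bsub>tensor_module R F B\<^esub> tensor_map R F B f Y"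
        using c d by (simp add: tensor_map_coset[OF F A B f] add_tensor_module)
    next
      fix r assume r: "r \<in> carrier R"
      then show "tensor_map R F B f (r \<odot>\<^bsub>tensor_module R F A\<^esub> X) =
          r \<odot>\<^bsub>tensor_module R F B\<^esub> tensor_map R F B f X"
        using c by (simp add: tensor_map_coset[OF F A B f] smult_tensor_module[OF F A]
            smult_tensor_module[OF F B] tensor_push_comp comp_def)
    }
  qed
qed

theorem tensor_map_elem:
  assumes "module R F" "module R A" "module R B" "f \<in> mod_hom R A B"
  shows "tensor_map R F B f (tensor_elem R F A x a) = tensor_elem R F B x (f a)"
  unfolding tensor_elem_def tensor_map_coset[OF assms] by simp

lemma inj_tensor_map_iff:
  assumes F: "module R F" and A: "module R A" and B: "module R B" and f: "f \<in> mod_hom R A B"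
  shows "inj_on (tensor_map R F B f) (carrier (tensor_module R F A)) \<longleftrightarrow>
    (\<forall>c. Poly_Mapping.keys c \<subseteq> carrier F \<times> carrier A \<longrightarrow> tensor_push id f c \<in> tensor_ker R F B \<longrightarrow>
       c \<in> tensor_ker R F A)" (is "?L \<longleftrightarrow> ?R")
proof
  assume L: ?L
  show ?R
  proof (intro allI impI)
    fix c assume c: "Poly_Mapping.keys c \<subseteq> carrier F \<times> carrier A" "tensor_push id f c \<in> tensor_ker R F B"
    have "tensor_ker R F A #>\<^bsub>tensor_free F A\<^esub> c = tensor_ker R F A #>\<^bsub>tensor_free F A\<^esub> 0"
      by (rule inj_onD[OF L])
         (use c in \<open>auto simp: carrier_tensor_module tensor_map_coset[OF assms] tensor_coset_eq_iff[OF F B]\<close>)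
    then show "c \<in> tensor_ker R F A" by (simp add: tensor_coset_eq_iff[OF F A])
  qed
next
  assume R: ?R
  show ?L
  proof (rule inj_onI)
    fix X Y assume XY: "X \<in> carrier (tensor_module R F A)" "Y \<in> carrier (tensor_module R F A)"
      "tensor_map R F B f X = tensor_map R F B f Y"
    then obtain c d where cd: "Poly_Mapping.keys c \<subseteq> carrier F \<times> carrier A" "Poly_Mapping.keys d \<subseteq> carrier F \<times> carrier A"
      "X = tensor_ker R F A #>\<^bsub>tensor_free F A\<^esub> c" "Y = tensor_ker R F A #>\<^bsub>tensor_free F A\<^esub> d"
      by (auto simp: carrier_tensor_module)
    then have "tensor_push id f (c - d) \<in> tensor_ker R F B"
      using XY(3) by (simp add: tensor_map_coset[OF assms] tensor_coset_eq_iff[OF F B])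
    then have "c - d \<in> tensor_ker R F A" using R keys_diff_subset[OF cd(1,2)] by blast
    then show "X = Y" using cd by (simp add: tensor_coset_eq_iff[OF F A])
  qed
qed

lemma mod_hom_inclusion:
  assumes "module R A" "submodule N R A"
  shows "id \<in> mod_hom R (A\<lparr>carrier := N\<rparr>) A"
  by (rule mod_homI) (use module.submoduleE(1)[OF assms] in auto)

lemma mod_hom_restrict:
  assumes "f \<in> mod_hom R A B" "M \<subseteq> carrier A" "\<And>x. x \<in> M \<Longrightarrow> f x \<in> N"
  shows "f \<in> mod_hom R (A\<lparr>carrier := M\<rparr>) (B\<lparr>carrier := N\<rparr>)"
  by (rule mod_homI) (use assms(3) mod_homD[OF assms(1)] subsetD[OF assms(2)] in auto)

lemma tensor_ker_mono:
  assumes "module R F" "module R A" "submodule N R A" "c \<in> tensor_ker R F (A\<lparr>carrier := N\<rparr>)"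
  shows "c \<in> tensor_ker R F A"
  using tensor_push_ker[OF assms(1) submodule.submodule_is_module[OF assms(3,2)] mod_hom_id
      mod_hom_inclusion[OF assms(2,3)] assms(1,2,4)]
  by (simp only: tensor_push_id)

lemma iso_copy_submodule_exists:
  fixes R :: "('r, 'x) ring_scheme" and A :: "('r, 'a, 'y) module_scheme" and e :: "'a \<Rightarrow> 'u"
  assumes "module R A" "submodule N R A" "inj_on e N"
  obtains B :: "('r, 'u) module" and d where "module R (A\<lparr>carrier := N\<rparr>)" "module R B"
    "e \<in> mod_hom R (A\<lparr>carrier := N\<rparr>) B" "d \<in> mod_hom R B (A\<lparr>carrier := N\<rparr>)"
    "\<And>x. x \<in> N \<Longrightarrow> d (e x) = x" "\<And>y. y \<in> carrier B \<Longrightarrow> e (d y) = y"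
    "\<And>x. x \<in> N \<Longrightarrow> e x \<in> carrier B" "\<And>y. y \<in> carrier B \<Longrightarrow> d y \<in> N"
proof -
  note N = submodule.submodule_is_module[OF assms(2,1)]
  have "inj_on e (carrier (A\<lparr>carrier := N\<rparr>))" using assms(3) by simp
  from iso_copy_exists[OF N this]
  obtain B :: "('r, 'u) module" and d where B: "module R B" "e \<in> mod_hom R (A\<lparr>carrier := N\<rparr>) B"
      "d \<in> mod_hom R B (A\<lparr>carrier := N\<rparr>)" "\<And>x. x \<in> carrier (A\<lparr>carrier := N\<rparr>) \<Longrightarrow> d (e x) = x"
      "\<And>y. y \<in> carrier B \<Longrightarrow> e (d y) = y"
    by metis
  show thesis
    by (rule that[OF N B(1-3) _ B(5)])
       (use B(4) mod_homD(1)[OF B(2)] mod_homD(1)[OF B(3)] in auto)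
qed

theorem flat_moduleD:
  fixes R :: "('r, 'x) ring_scheme" and F :: "('r, 'f, 'y) module_scheme"
    and A :: "('r, 'a, 'z) module_scheme" and B :: "('r, 'b, 'w) module_scheme"
  assumes flat: "flat_module R F" and A: "module R A" and B: "module R B"
    and f: "f \<in> mod_hom R A B" and inj: "inj_on f (carrier A)"
  shows "inj_on (tensor_map R F B f) (carrier (tensor_module R F A))"
proof -
  have F: "module R F" using flat by (simp add: flat_module_def)
  show ?thesis
    unfolding inj_tensor_map_iff[OF F A B f]
  proof (intro allI impI)
    fix c assume c: "Poly_Mapping.keys c \<subseteq> carrier F \<times> carrier A" "tensor_push id f c \<in> tensor_ker R F B"
    obtain S where S: "finite S" "S \<subseteq> carrier B"
      "\<And>N. submodule N R B \<Longrightarrow> S \<subseteq> N \<Longrightarrow> tensor_push id f c \<in> tensor_ker R F (B\<lparr>carrier := N\<rparr>)"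
      using tensor_ker_finite_support[OF F B c(2)] by blast
    have "finite (S \<union> f ` snd ` Poly_Mapping.keys c)" "S \<union> f ` snd ` Poly_Mapping.keys c \<subseteq> carrier B"
      using S c(1) mod_homD(1)[OF f] by auto
    from small_submodule_exists[OF B this]
    obtain B0 and e :: "'b \<Rightarrow> 'r list" where B0: "submodule B0 R B" "S \<union> f ` snd ` Poly_Mapping.keys c \<subseteq> B0"
      and e: "inj_on e B0" by blast
    define A0 where "A0 = {x \<in> carrier A. f x \<in> B0}"
    have A0: "submodule A0 R A" unfolding A0_def by (rule submodule_vimage[OF A B f B0(1)])
    have cA0: "Poly_Mapping.keys c \<subseteq> carrier F \<times> A0" using c(1) B0(2) by (force simp: A0_def)
    have "inj_on (e \<circ> f) A0"
      using inj e by (auto simp: A0_def inj_on_def)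
    then obtain A' :: "('r, 'r list) module" and dA where A':
      "module R (A\<lparr>carrier := A0\<rparr>)" "module R A'"
      "e \<circ> f \<in> mod_hom R (A\<lparr>carrier := A0\<rparr>) A'" "dA \<in> mod_hom R A' (A\<lparr>carrier := A0\<rparr>)"
      "\<And>x. x \<in> A0 \<Longrightarrow> dA ((e \<circ> f) x) = x" "\<And>y. y \<in> carrier A' \<Longrightarrow> (e \<circ> f) (dA y) = y"
      "\<And>x. x \<in> A0 \<Longrightarrow> (e \<circ> f) x \<in> carrier A'" "\<And>y. y \<in> carrier A' \<Longrightarrow> dA y \<in> A0"
      by (rule iso_copy_submodule_exists[OF A A0]) blast
    obtain B' :: "('r, 'r list) module" where B':
      "module R (B\<lparr>carrier := B0\<rparr>)" "module R B'"
      "e \<in> mod_hom R (B\<lparr>carrier := B0\<rparr>) B'"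
      by (rule iso_copy_submodule_exists[OF B B0(1) e]) blast
    define f' where "f' = e \<circ> f \<circ> dA"
    have "f \<in> mod_hom R (A\<lparr>carrier := A0\<rparr>) (B\<lparr>carrier := B0\<rparr>)"
      by (rule mod_hom_restrict[OF f]) (auto simp: A0_def)
    from mod_hom_comp[OF A'(4) mod_hom_comp[OF this B'(3)]]
    have f': "f' \<in> mod_hom R A' B'" unfolding f'_def .
    have "inj_on f' (carrier A')"
      unfolding f'_def using A'(6) by (simp add: inj_on_def)
    then have "inj_on (tensor_map R F B' f') (carrier (tensor_module R F A'))"
      using flat A'(2) B'(2) f' unfolding flat_module_def by blast
    note * = this[unfolded inj_tensor_map_iff[OF F A'(2) B'(2) f'], rule_format]
    define c' where "c' = tensor_push id (e \<circ> f) c"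
    have kc': "Poly_Mapping.keys c' \<subseteq> carrier F \<times> carrier A'"
      unfolding c'_def by (rule tensor_push_keys[OF cA0]) (use A'(7) in auto)
    have "tensor_push id f' c' = tensor_push id e (tensor_push id f c)"
      unfolding c'_def tensor_push_comp f'_def
      by (rule tensor_push_cong[OF cA0]) (use A'(5) in auto)
    also have "\<dots> \<in> tensor_ker R F B'"
      by (rule tensor_push_ker[OF F B'(1) mod_hom_id B'(3) F B'(2)]) (use S(3) B0 in auto)
    finally have "c' \<in> tensor_ker R F A'" by (rule *[OF kc'])
    then have "tensor_push id dA c' \<in> tensor_ker R F (A\<lparr>carrier := A0\<rparr>)"
      by (rule tensor_push_ker[OF F A'(2) mod_hom_id A'(4) F A'(1)])
    moreover have "tensor_push id dA c' = tensor_push id id c"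
      unfolding c'_def tensor_push_comp by (rule tensor_push_cong[OF cA0]) (use A'(5) in auto)
    ultimately show "c \<in> tensor_ker R F A"
      using tensor_ker_mono[OF F A A0] by (simp only: tensor_push_id)
  qed
qed

lemma exact_at_tensor_iff:
  assumes F: "module R F" and A: "module R A" and B: "module R B" and C: "module R C"
    and f: "f \<in> mod_hom R A B" and g: "g \<in> mod_hom R B C"
  shows "exact_at (tensor_module R F A) (tensor_map R F B f) (tensor_module R F B)
          (tensor_map R F C g) (tensor_module R F C) \<longleftrightarrow>
    (\<forall>a :: _ \<Rightarrow>\<^sub>0 int. Poly_Mapping.keys a \<subseteq> carrier F \<times> carrier A \<longrightarrow>
       tensor_push id (g \<circ> f) a \<in> tensor_ker R F C) \<and>
    (\<forall>c. Poly_Mapping.keys c \<subseteq> carrier F \<times> carrier B \<longrightarrow> tensor_push id g c \<in> tensor_ker R F C \<longrightarrow>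
       (\<exists>a. Poly_Mapping.keys a \<subseteq> carrier F \<times> carrier A \<and> c - tensor_push id f a \<in> tensor_ker R F B))"
    (is "?L \<longleftrightarrow> ?R1 \<and> ?R2")
proof -
  let ?KA = "\<lambda>c. tensor_ker R F A #>\<^bsub>tensor_free F A\<^esub> c"
  let ?KB = "\<lambda>c. tensor_ker R F B #>\<^bsub>tensor_free F B\<^esub> c"
  let ?fA = "{a. Poly_Mapping.keys a \<subseteq> carrier F \<times> carrier A}"
  let ?fB = "{c. Poly_Mapping.keys c \<subseteq> carrier F \<times> carrier B}"
  have im: "tensor_map R F B f ` carrier (tensor_module R F A) = (\<lambda>a. ?KB (tensor_push id f a)) ` ?fA"
    by (simp add: carrier_tensor_module image_image tensor_map_coset[OF F A B f])
  have ker: "a_kernel (tensor_module R F B) (tensor_module R F C) (tensor_map R F C g)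
      = ?KB ` {c \<in> ?fB. tensor_push id g c \<in> tensor_ker R F C}"
  proof -
    have "tensor_map R F C g (?KB c) = \<zero>\<^bsub>tensor_module R F C\<^esub> \<longleftrightarrow> tensor_push id g c \<in> tensor_ker R F C" for c
      by (simp add: tensor_map_coset[OF F B C g] zero_tensor_module tensor_coset_eq_iff[OF F C])
    then show ?thesis unfolding a_kernel_def' carrier_tensor_module by blast
  qed
  have kf: "Poly_Mapping.keys (tensor_push id f a) \<subseteq> carrier F \<times> carrier B" if "a \<in> ?fA" for a
    using that mod_homD(1)[OF f] by (intro tensor_push_keys[of a "carrier F" "carrier A"]) auto
  have *: "tensor_push id g c \<in> tensor_ker R F C \<longleftrightarrow> tensor_push id g d \<in> tensor_ker R F C"
    if "?KB c = ?KB d" for c d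
  proof -
    have "tensor_push id g (c - d) \<in> tensor_ker R F C"
      using tensor_push_ker[OF F B mod_hom_id g F C] that by (simp only: tensor_coset_eq_iff[OF F B])
    then have e: "tensor_push id g c - tensor_push id g d \<in> tensor_ker R F C" by simp
    show ?thesis
      using tensor_ker_add[OF e, of "tensor_push id g d"] tensor_ker_diff[OF F C _ e, of "tensor_push id g c"] by auto
  qed
  show ?thesis
  proof (intro iffI conjI)
    assume L: ?L
    show ?R1
    proof (intro allI impI)
      fix a :: "_ \<Rightarrow>\<^sub>0 int" assume a: "Poly_Mapping.keys a \<subseteq> carrier F \<times> carrier A"
      then have "?KB (tensor_push id f a) \<in> ?KB ` {c \<in> ?fB. tensor_push id g c \<in> tensor_ker R F C}"
        using L unfolding exact_at_def im ker by blast
      then obtain c where c: "?KB (tensor_push id f a) = ?KB c" "tensor_push id g c \<in> tensor_ker R F C"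
        by blast
      then have "tensor_push id g (tensor_push id f a) \<in> tensor_ker R F C" using *[OF c(1)] by simp
      then show "tensor_push id (g \<circ> f) a \<in> tensor_ker R F C" by (simp add: tensor_push_comp)
    qed
    show ?R2
    proof (intro allI impI)
      fix c assume c: "Poly_Mapping.keys c \<subseteq> carrier F \<times> carrier B" "tensor_push id g c \<in> tensor_ker R F C"
      then have "?KB c \<in> (\<lambda>a. ?KB (tensor_push id f a)) ` ?fA"
        using L unfolding exact_at_def im ker by blast
      then show "\<exists>a. Poly_Mapping.keys a \<subseteq> carrier F \<times> carrier A \<and> c - tensor_push id f a \<in> tensor_ker R F B"
        by (auto simp: tensor_coset_eq_iff[OF F B])
    qed
  next
    assume R: "?R1 \<and> ?R2"
    show ?L
      unfolding exact_at_def im ker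
    proof
      show "(\<lambda>a. ?KB (tensor_push id f a)) ` ?fA \<subseteq> ?KB ` {c \<in> ?fB. tensor_push id g c \<in> tensor_ker R F C}"
      proof clarify
        fix a :: "_ \<Rightarrow>\<^sub>0 int" assume a: "Poly_Mapping.keys a \<subseteq> carrier F \<times> carrier A"
        then have "tensor_push id g (tensor_push id f a) \<in> tensor_ker R F C"
          using R by (simp add: tensor_push_comp)
        then show "?KB (tensor_push id f a) \<in> ?KB ` {c \<in> ?fB. tensor_push id g c \<in> tensor_ker R F C}"
          using kf[of a] a by blast
      qed
      show "?KB ` {c \<in> ?fB. tensor_push id g c \<in> tensor_ker R F C} \<subseteq> (\<lambda>a. ?KB (tensor_push id f a)) ` ?fA"
      proof clarify
        fix c assume c: "Poly_Mapping.keys c \<subseteq> carrier F \<times> carrier B" "tensor_push id g c \<in> tensor_ker R F C"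
        then obtain a where a: "a \<in> ?fA" "c - tensor_push id f a \<in> tensor_ker R F B" using R by blast
        then have "?KB c = ?KB (tensor_push id f a)" by (simp add: tensor_coset_eq_iff[OF F B])
        then show "?KB c \<in> (\<lambda>a. ?KB (tensor_push id f a)) ` ?fA" using a(1) by blast
      qed
    qed
  qed
qed

lemma tensor_ker_zero_right:
  assumes F: "module R F" and M: "module R M" and c: "Poly_Mapping.keys c \<subseteq> carrier F \<times> {\<zero>\<^bsub>M\<^esub>}"
  shows "c \<in> tensor_ker R F M"
  using c
proof (induction c rule: frag_induction)
  case zero
  then show ?case by (rule tensor_ker_zero)
next
  case (one a)
  interpret M: module R M by fact
  from one obtain x where a: "a = (x, \<zero>\<^bsub>M\<^esub>)" "x \<in> carrier F" by auto
  then have "frag_of (x, \<zero>\<^bsub>M\<^esub> \<oplus>\<^bsub>M\<^esub> \<zero>\<^bsub>M\<^esub>) - frag_of (x, \<zero>\<^bsub>M\<^esub>) - frag_of (x, \<zero>\<^bsub>M\<^esub>) \<in> tensor_rel R F M"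
    unfolding tensor_rel_def by blast
  then have "- frag_of a \<in> tensor_ker R F M"
    using tensor_ker_rel a(1) by fastforce
  then show ?case using tensor_ker_minus[OF F M, of "- frag_of a"] by simp
next
  case (diff a b)
  then show ?case using tensor_ker_diff[OF F M] by blast
qed

lemma zero_module:
  assumes "module R A" shows "module R (A\<lparr>carrier := {\<zero>\<^bsub>A\<^esub>}\<rparr>)"
  by (rule submodule.submodule_is_module[OF submodule_zero assms]) fact

theorem faithfully_flat_imp_flat:
  fixes R :: "('r, 'x) ring_scheme" and F :: "('r, 'f, 'y) module_scheme"
  assumes ff: "faithfully_flat_module R F"
  shows "flat_module R F"
  unfolding flat_module_def
proof (intro conjI allI impI)
  show F: "module R F" using ff by (simp add: faithfully_flat_module_def)
  fix A B :: "('r, 'r list) module" and f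
  assume A: "module R A" and B: "module R B" and f: "f \<in> mod_hom R A B" and inj: "inj_on f (carrier A)"
  interpret A: module R A by fact
  let ?Z = "A\<lparr>carrier := {\<zero>\<^bsub>A\<^esub>}\<rparr>"
  note Z = zero_module[OF A]
  have id: "id \<in> mod_hom R ?Z A" by (rule mod_hom_inclusion[OF A submodule_zero[OF A]])
  have "x = \<zero>\<^bsub>A\<^esub>" if "x \<in> carrier A" "f x = \<zero>\<^bsub>B\<^esub>" for x
    using that inj_onD[OF inj] mod_hom_zero[OF A B f] by simp
  then have "exact_at ?Z id A f B"
    using mod_hom_zero[OF A B f] by (auto simp: exact_at_def a_kernel_def')
  then have "exact_at (tensor_module R F ?Z) (tensor_map R F A id) (tensor_module R F A)
          (tensor_map R F B f) (tensor_module R F B)"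
    using ff Z A B id f unfolding faithfully_flat_module_def by blast
  note ex = this[unfolded exact_at_tensor_iff[OF F Z A B id f], THEN conjunct2, rule_format]
  show "inj_on (tensor_map R F B f) (carrier (tensor_module R F A))"
    unfolding inj_tensor_map_iff[OF F A B f]
  proof (intro allI impI)
    fix c assume "Poly_Mapping.keys c \<subseteq> carrier F \<times> carrier A" "tensor_push id f c \<in> tensor_ker R F B"
    from ex[OF this] obtain a where a: "Poly_Mapping.keys a \<subseteq> carrier F \<times> {\<zero>\<^bsub>A\<^esub>}"
      "c - a \<in> tensor_ker R F A"
      by (auto simp: tensor_push_id)
    from tensor_ker_add[OF a(2) tensor_ker_zero_right[OF F A a(1)]]
    show "c \<in> tensor_ker R F A" by simp
  qed
qed

lemma faithfully_flat_elem_zero: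
  fixes R :: "('r, 'x) ring_scheme" and F :: "('r, 'f, 'y) module_scheme" and D :: "('r, 'd, 'z) module_scheme"
  assumes ff: "faithfully_flat_module R F" and D: "module R D" and d: "d \<in> carrier D"
    and z: "\<And>x. x \<in> carrier F \<Longrightarrow> frag_of (x, d) \<in> tensor_ker R F D"
  shows "d = \<zero>\<^bsub>D\<^esub>"
proof -
  have F: "module R F" using ff by (simp add: faithfully_flat_module_def)
  interpret F: module R F by fact
  interpret D: module R D by fact
  define D1 where "D1 = {r \<odot>\<^bsub>D\<^esub> d | r. r \<in> carrier R}"
  have D1I: "y \<in> D1" if "r \<in> carrier R" "y = r \<odot>\<^bsub>D\<^esub> d" for r y using that by (auto simp: D1_def)
  have D1: "submodule D1 R D"
  proof (rule D.submoduleI)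
    show "D1 \<subseteq> carrier D" using d by (auto simp: D1_def)
    show "\<zero>\<^bsub>D\<^esub> \<in> D1" using d by (intro D1I[of "\<zero>\<^bsub>R\<^esub>"]) auto
    show "\<ominus>\<^bsub>D\<^esub> a \<in> D1" if a: "a \<in> D1" for a
    proof -
      obtain r where "r \<in> carrier R" "a = r \<odot>\<^bsub>D\<^esub> d" using a by (auto simp: D1_def)
      then show ?thesis using d by (intro D1I[of "\<ominus>\<^bsub>R\<^esub> r"]) (auto simp: D.smult_l_minus)
    qed
    show "a \<oplus>\<^bsub>D\<^esub> b \<in> D1" if ab: "a \<in> D1" "b \<in> D1" for a b
    proof -
      obtain r s where "r \<in> carrier R" "a = r \<odot>\<^bsub>D\<^esub> d" "s \<in> carrier R" "b = s \<odot>\<^bsub>D\<^esub> d"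
        using ab by (auto simp: D1_def)
      then show ?thesis using d by (intro D1I[of "r \<oplus>\<^bsub>R\<^esub> s"]) (auto simp: D.smult_l_distr)
    qed
    show "a \<odot>\<^bsub>D\<^esub> y \<in> D1" if a: "a \<in> carrier R" "y \<in> D1" for a y
    proof -
      obtain r where "r \<in> carrier R" "y = r \<odot>\<^bsub>D\<^esub> d" using a by (auto simp: D1_def)
      then show ?thesis using d a by (intro D1I[of "a \<otimes>\<^bsub>R\<^esub> r"]) (auto simp: D.smult_assoc1)
    qed
  qed
  have dD1: "d \<in> D1" using d by (intro D1I[of "\<one>\<^bsub>R\<^esub>"]) auto
  define e where "e = (\<lambda>y. [SOME r. r \<in> carrier R \<and> y = r \<odot>\<^bsub>D\<^esub> d])"
  have e_eq: "y = hd (e y) \<odot>\<^bsub>D\<^esub> d" if "y \<in> D1" for y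
  proof -
    have "\<exists>r. r \<in> carrier R \<and> y = r \<odot>\<^bsub>D\<^esub> d" using that by (auto simp: D1_def)
    from someI_ex[OF this] show ?thesis unfolding e_def list.sel by (rule conjunct2)
  qed
  have inj: "inj_on e D1" using e_eq by (metis inj_onI)
  obtain E :: "('r, 'r list) module" and h where E: "module R (D\<lparr>carrier := D1\<rparr>)" "module R E"
    "e \<in> mod_hom R (D\<lparr>carrier := D1\<rparr>) E" "h \<in> mod_hom R E (D\<lparr>carrier := D1\<rparr>)"
    "\<And>x. x \<in> D1 \<Longrightarrow> h (e x) = x" "\<And>y. y \<in> carrier E \<Longrightarrow> e (h y) = y"
    "\<And>x. x \<in> D1 \<Longrightarrow> e x \<in> carrier E" "\<And>y. y \<in> carrier E \<Longrightarrow> h y \<in> D1"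
    by (rule iso_copy_submodule_exists[OF D D1 inj]) blast
  have gen: "frag_of (x, y) \<in> tensor_ker R F D" if xy: "x \<in> carrier F" "y \<in> D1" for x y
  proof -
    obtain r where r: "r \<in> carrier R" "y = r \<odot>\<^bsub>D\<^esub> d" using xy by (auto simp: D1_def)
    have "frag_of (r \<odot>\<^bsub>F\<^esub> x, d) - frag_of (x, r \<odot>\<^bsub>D\<^esub> d) \<in> tensor_rel R F D"
      using r xy d unfolding tensor_rel_def by blast
    from tensor_ker_diff[OF F D z[of "r \<odot>\<^bsub>F\<^esub> x"] tensor_ker_rel[OF this]]
    show ?thesis using r xy by simp
  qed
  have genD: "c \<in> tensor_ker R F D" if "Poly_Mapping.keys c \<subseteq> carrier F \<times> D1" for c
    using that
    by (induction c rule: frag_induction) (auto intro: tensor_ker_zero gen tensor_ker_diff[OF F D])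
  have incl: "inj_on (tensor_map R F D id) (carrier (tensor_module R F (D\<lparr>carrier := D1\<rparr>)))"
    by (rule flat_moduleD[OF faithfully_flat_imp_flat[OF ff] E(1) D mod_hom_inclusion[OF D D1]]) simp
  have genD1: "c \<in> tensor_ker R F (D\<lparr>carrier := D1\<rparr>)" if "Poly_Mapping.keys c \<subseteq> carrier F \<times> D1" for c
    using incl[unfolded inj_tensor_map_iff[OF F E(1) D mod_hom_inclusion[OF D D1]], rule_format, of c]
      genD[OF that] that by (simp add: tensor_push_id)
  have genE: "c \<in> tensor_ker R F E" if c: "Poly_Mapping.keys c \<subseteq> carrier F \<times> carrier E" for c
  proof -
    have "tensor_push id h c \<in> tensor_ker R F (D\<lparr>carrier := D1\<rparr>)"
      by (rule genD1, rule tensor_push_keys[OF c]) (use E(8) in auto)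
    then have "tensor_push id e (tensor_push id h c) \<in> tensor_ker R F E"
      by (rule tensor_push_ker[OF F E(1) mod_hom_id E(3) F E(2)])
    moreover have "tensor_push id e (tensor_push id h c) = tensor_push id id c"
      unfolding tensor_push_comp by (rule tensor_push_cong[OF c]) (use E(6) in auto)
    ultimately show ?thesis by (simp only: tensor_push_id)
  qed
  let ?Z = "E\<lparr>carrier := {\<zero>\<^bsub>E\<^esub>}\<rparr>"
  note Z = zero_module[OF E(2)]
  interpret E: module R E by (rule E(2))
  have id: "id \<in> mod_hom R ?Z E" by (rule mod_hom_inclusion[OF E(2) submodule_zero[OF E(2)]])
  have g: "(\<lambda>_. \<zero>\<^bsub>E\<^esub>) \<in> mod_hom R E ?Z" by (rule mod_homI) auto
  have "exact_at (tensor_module R F ?Z) (tensor_map R F E id) (tensor_module R F E)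
          (tensor_map R F ?Z (\<lambda>_. \<zero>\<^bsub>E\<^esub>)) (tensor_module R F ?Z)"
    unfolding exact_at_tensor_iff[OF F Z E(2) Z id g]
  proof (intro conjI allI impI)
    fix a :: "_ \<Rightarrow>\<^sub>0 int" assume a: "Poly_Mapping.keys a \<subseteq> carrier F \<times> carrier ?Z"
    show "tensor_push id ((\<lambda>_. \<zero>\<^bsub>E\<^esub>) \<circ> id) a \<in> tensor_ker R F ?Z"
      by (rule tensor_ker_zero_right[OF F Z], rule tensor_push_keys[OF a]) auto
  next
    fix c :: "_ \<Rightarrow>\<^sub>0 int" assume "Poly_Mapping.keys c \<subseteq> carrier F \<times> carrier E"
    from genE[OF this]
    show "\<exists>a. Poly_Mapping.keys a \<subseteq> carrier F \<times> carrier ?Z \<and> c - tensor_push id id a \<in> tensor_ker R F E"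
      by (intro exI[of _ 0]) simp
  qed
  then have "exact_at ?Z id E (\<lambda>_. \<zero>\<^bsub>E\<^esub>) ?Z"
    using ff Z E(2) id g unfolding faithfully_flat_module_def by blast
  then have "carrier E = {\<zero>\<^bsub>E\<^esub>}" by (auto simp: exact_at_def a_kernel_def')
  then have "e d = \<zero>\<^bsub>E\<^esub>" "e \<zero>\<^bsub>D\<^esub> = \<zero>\<^bsub>E\<^esub>" using E(7) dD1 submodule_zero_mem[OF D1] by auto
  then show ?thesis
    using inj_onD[OF inj, of d "\<zero>\<^bsub>D\<^esub>"] dD1 submodule_zero_mem[OF D1] by simp
qed

theorem faithfully_flat_moduleD:
  fixes R :: "('r, 'x) ring_scheme" and F :: "('r, 'f, 'y) module_scheme"
    and A :: "('r, 'a, 'z) module_scheme" and B :: "('r, 'b, 'w) module_scheme"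
    and C :: "('r, 'c, 'v) module_scheme"
  assumes ff: "faithfully_flat_module R F" and A: "module R A" and B: "module R B" and C: "module R C"
    and f: "f \<in> mod_hom R A B" and g: "g \<in> mod_hom R B C"
  shows "exact_at A f B g C \<longleftrightarrow>
    exact_at (tensor_module R F A) (tensor_map R F B f) (tensor_module R F B)
          (tensor_map R F C g) (tensor_module R F C)"
proof -
  have F: "module R F" using ff by (simp add: faithfully_flat_module_def)
  interpret A: module R A by fact
  interpret B: module R B by fact
  interpret C: module R C by fact
  note iff = exact_at_tensor_iff[OF F A B C f g]
  show ?thesis
  proof
    assume ex: "exact_at A f B g C"
    have gf: "g (f x) = \<zero>\<^bsub>C\<^esub>" if "x \<in> carrier A" for x
      using ex that by (auto simp: exact_at_def a_kernel_def')
    show "exact_at (tensor_module R F A) (tensor_map R F B f) (tensor_module R F B)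
          (tensor_map R F C g) (tensor_module R F C)"
      unfolding iff
    proof (intro conjI allI impI)
      fix a :: "_ \<Rightarrow>\<^sub>0 int" assume a: "Poly_Mapping.keys a \<subseteq> carrier F \<times> carrier A"
      show "tensor_push id (g \<circ> f) a \<in> tensor_ker R F C"
        by (rule tensor_ker_zero_right[OF F C], rule tensor_push_keys[OF a]) (use gf in auto)
    next
      fix c assume c: "Poly_Mapping.keys c \<subseteq> carrier F \<times> carrier B" "tensor_push id g c \<in> tensor_ker R F C"
      obtain S where S: "finite S" "S \<subseteq> carrier C"
        "\<And>N. submodule N R C \<Longrightarrow> S \<subseteq> N \<Longrightarrow> tensor_push id g c \<in> tensor_ker R F (C\<lparr>carrier := N\<rparr>)"
        using tensor_ker_finite_support[OF F C c(2)] by blast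
      have "finite (S \<union> g ` snd ` Poly_Mapping.keys c)" "S \<union> g ` snd ` Poly_Mapping.keys c \<subseteq> carrier C"
        using S c(1) mod_homD(1)[OF g] by auto
      from small_submodule_exists[OF C this]
      obtain C0 and eC :: "'c \<Rightarrow> 'r list" where C0: "submodule C0 R C" "S \<union> g ` snd ` Poly_Mapping.keys c \<subseteq> C0"
        and eC: "inj_on eC C0" by blast
      have "finite (snd ` Poly_Mapping.keys c)" "snd ` Poly_Mapping.keys c \<subseteq> carrier B"
        using c(1) by auto
      from small_submodule_exists[OF B this]
      obtain B1 and eB :: "'b \<Rightarrow> 'r list" where B1: "submodule B1 R B" "snd ` Poly_Mapping.keys c \<subseteq> B1"
        and eB1: "inj_on eB B1" by blast
      define B0 where "B0 = B1 \<inter> {x \<in> carrier B. g x \<in> C0}"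
      have B0: "submodule B0 R B"
        unfolding B0_def by (intro submodule_Int B B1(1) submodule_vimage[OF B C g C0(1)])
      have cB0: "Poly_Mapping.keys c \<subseteq> carrier F \<times> B0" using c(1) B1(2) C0(2) by (force simp: B0_def)
      have eB: "inj_on eB B0" using eB1 by (rule inj_on_subset) (auto simp: B0_def)
      define A0 where "A0 = B0 \<inter> {x \<in> carrier B. g x \<in> {\<zero>\<^bsub>C\<^esub>}}"
      have A0: "submodule A0 R B"
        unfolding A0_def by (intro submodule_Int B B0 submodule_vimage[OF B C g] submodule_zero[OF C])
      have eA: "inj_on eB A0" using eB by (rule inj_on_subset) (auto simp: A0_def)
      obtain A' :: "('r, 'r list) module" and dA where A':
        "module R (B\<lparr>carrier := A0\<rparr>)" "module R A'"
        "eB \<in> mod_hom R (B\<lparr>carrier := A0\<rparr>) A'" "dA \<in> mod_hom R A' (B\<lparr>carrier := A0\<rparr>)"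
        "\<And>x. x \<in> A0 \<Longrightarrow> dA (eB x) = x" "\<And>y. y \<in> carrier A' \<Longrightarrow> eB (dA y) = y"
        "\<And>x. x \<in> A0 \<Longrightarrow> eB x \<in> carrier A'" "\<And>y. y \<in> carrier A' \<Longrightarrow> dA y \<in> A0"
        by (rule iso_copy_submodule_exists[OF B A0 eA]) blast
      obtain B' :: "('r, 'r list) module" and dB where B':
        "module R (B\<lparr>carrier := B0\<rparr>)" "module R B'"
        "eB \<in> mod_hom R (B\<lparr>carrier := B0\<rparr>) B'" "dB \<in> mod_hom R B' (B\<lparr>carrier := B0\<rparr>)"
        "\<And>x. x \<in> B0 \<Longrightarrow> dB (eB x) = x" "\<And>y. y \<in> carrier B' \<Longrightarrow> eB (dB y) = y"
        "\<And>x. x \<in> B0 \<Longrightarrow> eB x \<in> carrier B'" "\<And>y. y \<in> carrier B' \<Longrightarrow> dB y \<in> B0"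
        by (rule iso_copy_submodule_exists[OF B B0 eB]) blast
      obtain C' :: "('r, 'r list) module" and dC where C':
        "module R (C\<lparr>carrier := C0\<rparr>)" "module R C'"
        "eC \<in> mod_hom R (C\<lparr>carrier := C0\<rparr>) C'" "\<And>x. x \<in> C0 \<Longrightarrow> dC (eC x) = x"
        by (rule iso_copy_submodule_exists[OF C C0(1) eC]) blast
      have sub: "A0 \<subseteq> B0" "B0 \<subseteq> carrier B" by (auto simp: A0_def B0_def)
      define f' where "f' = eB \<circ> id \<circ> dA"
      define g' where "g' = eC \<circ> g \<circ> dB"
      have "id \<in> mod_hom R (B\<lparr>carrier := A0\<rparr>) (B\<lparr>carrier := B0\<rparr>)"
        by (rule mod_hom_restrict[OF mod_hom_id]) (use sub in auto)
      from mod_hom_comp[OF A'(4) mod_hom_comp[OF this B'(3)]]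
      have f': "f' \<in> mod_hom R A' B'" unfolding f'_def .
      have "g \<in> mod_hom R (B\<lparr>carrier := B0\<rparr>) (C\<lparr>carrier := C0\<rparr>)"
        by (rule mod_hom_restrict[OF g sub(2)]) (auto simp: B0_def)
      from mod_hom_comp[OF B'(4) mod_hom_comp[OF this C'(3)]]
      have g': "g' \<in> mod_hom R B' C'" unfolding g'_def .
      have eC0: "eC x = \<zero>\<^bsub>C'\<^esub> \<longleftrightarrow> x = \<zero>\<^bsub>C\<^esub>" if "x \<in> C0" for x
        using mod_hom_zero[OF C'(1,2,3)] C'(4)[OF that] C'(4)[OF submodule_zero_mem[OF C0(1)]] by auto
      have "f' ` carrier A' = a_kernel B' C' g'"
      proof (intro equalityI subsetI)
        fix y assume "y \<in> f' ` carrier A'"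
        then obtain x where x: "x \<in> carrier A'" "y = eB (dA x)" by (auto simp: f'_def)
        have dx: "dA x \<in> A0" by (rule A'(8)[OF x(1)])
        then have "y \<in> carrier B'" "dB y = dA x" using sub B'(5,7) x(2) by auto
        moreover have "g (dA x) = \<zero>\<^bsub>C\<^esub>" using dx by (simp add: A0_def)
        ultimately show "y \<in> a_kernel B' C' g'"
          using eC0[OF submodule_zero_mem[OF C0(1)]] by (simp add: a_kernel_def' g'_def)
      next
        fix y assume "y \<in> a_kernel B' C' g'"
        then have y: "y \<in> carrier B'" "eC (g (dB y)) = \<zero>\<^bsub>C'\<^esub>" by (auto simp: a_kernel_def' g'_def)
        have dy: "dB y \<in> B0" by (rule B'(8)[OF y(1)])
        then have "g (dB y) = \<zero>\<^bsub>C\<^esub>" using eC0[of "g (dB y)"] y(2) by (simp add: B0_def)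
        then have yA: "dB y \<in> A0" using dy sub by (auto simp: A0_def)
        then have "f' (eB (dB y)) = y" using A'(5)[OF yA] B'(6)[OF y(1)] by (simp add: f'_def)
        then show "y \<in> f' ` carrier A'" using A'(7)[OF yA] by (metis imageI)
      qed
      then have "exact_at A' f' B' g' C'" by (simp add: exact_at_def)
      then have "exact_at (tensor_module R F A') (tensor_map R F B' f') (tensor_module R F B')
          (tensor_map R F C' g') (tensor_module R F C')"
        using ff A'(2) B'(2) C'(2) f' g' unfolding faithfully_flat_module_def by blast
      note ex' = this[unfolded exact_at_tensor_iff[OF F A'(2) B'(2) C'(2) f' g'], THEN conjunct2, rule_format]
      have kc': "Poly_Mapping.keys (tensor_push id eB c) \<subseteq> carrier F \<times> carrier B'"
        by (rule tensor_push_keys[OF cB0]) (use B'(7) in auto)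
      have "tensor_push id g' (tensor_push id eB c) = tensor_push id eC (tensor_push id g c)"
        unfolding g'_def tensor_push_comp by (rule tensor_push_cong[OF cB0]) (use B'(5) in auto)
      also have "\<dots> \<in> tensor_ker R F C'"
        by (rule tensor_push_ker[OF F C'(1) mod_hom_id C'(3) F C'(2)]) (use S(3) C0 in auto)
      finally obtain a where a: "Poly_Mapping.keys a \<subseteq> carrier F \<times> carrier A'"
          "tensor_push id eB c - tensor_push id f' a \<in> tensor_ker R F B'"
        using ex'[OF kc'] by blast
      from tensor_push_ker[OF F B'(2) mod_hom_id B'(4) F B'(1) a(2)]
      have "tensor_push id dB (tensor_push id eB c) - tensor_push id dB (tensor_push id f' a)
          \<in> tensor_ker R F (B\<lparr>carrier := B0\<rparr>)" by simp
      moreover have "tensor_push id dB (tensor_push id eB c) = tensor_push id id c"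
        unfolding tensor_push_comp by (rule tensor_push_cong[OF cB0]) (use B'(5) in auto)
      moreover have "tensor_push id dB (tensor_push id f' a) = tensor_push id dA a"
        unfolding tensor_push_comp f'_def by (rule tensor_push_cong[OF a(1)]) (use B'(5) A'(8) sub in auto)
      ultimately have ca: "c - tensor_push id dA a \<in> tensor_ker R F B"
        using tensor_ker_mono[OF F B B0] by (simp only: tensor_push_id)
      have "\<exists>u. u \<in> carrier A \<and> f u = x" if "x \<in> A0" for x
      proof -
        have "x \<in> a_kernel B C g" using that by (auto simp: A0_def a_kernel_def')
        then have "x \<in> f ` carrier A" using ex by (simp add: exact_at_def)
        then show ?thesis by auto
      qed
      then obtain s where s: "\<And>x. x \<in> A0 \<Longrightarrow> s x \<in> carrier A \<and> f (s x) = x" by metis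
      have "tensor_push id f (tensor_push id (s \<circ> dA) a) = tensor_push id dA a"
        unfolding tensor_push_comp by (rule tensor_push_cong[OF a(1)]) (use s A'(8) in auto)
      moreover have "Poly_Mapping.keys (tensor_push id (s \<circ> dA) a) \<subseteq> carrier F \<times> carrier A"
        by (rule tensor_push_keys[OF a(1)]) (use s A'(8) in auto)
      ultimately show "\<exists>a. Poly_Mapping.keys a \<subseteq> carrier F \<times> carrier A \<and> c - tensor_push id f a \<in> tensor_ker R F B"
        using ca by (intro exI[of _ "tensor_push id (s \<circ> dA) a"]) simp
    qed
  next
    assume "exact_at (tensor_module R F A) (tensor_map R F B f) (tensor_module R F B)
          (tensor_map R F C g) (tensor_module R F C)"
    note ex = this[unfolded iff]
    have gf: "g (f a) = \<zero>\<^bsub>C\<^esub>" if a: "a \<in> carrier A" for a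
    proof (rule faithfully_flat_elem_zero[OF ff C])
      show "g (f a) \<in> carrier C" using a mod_homD(1)[OF f] mod_homD(1)[OF g] by simp
      fix x assume x: "x \<in> carrier F"
      then show "frag_of (x, g (f a)) \<in> tensor_ker R F C"
        using ex[THEN conjunct1, rule_format, of "frag_of (x, a)"] a by simp
    qed
    let ?I = "f ` carrier A"
    have I: "submodule ?I R B" by (rule mod_hom_image_submodule[OF A B f])
    note IE = B.submoduleE[OF I]
    define q where "q = (\<lambda>x. {y \<in> carrier B. y \<ominus>\<^bsub>B\<^esub> x \<in> ?I})"
    have q: "q x = q y \<longleftrightarrow> x \<ominus>\<^bsub>B\<^esub> y \<in> ?I" if xy: "x \<in> carrier B" "y \<in> carrier B" for x y
    proof
      assume e: "q x = q y"
      have "x \<in> q x" using xy submodule_zero_mem[OF I] by (simp add: q_def B.minus_eq B.r_neg)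
      then show "x \<ominus>\<^bsub>B\<^esub> y \<in> ?I" unfolding e by (simp add: q_def)
    next
      assume d: "x \<ominus>\<^bsub>B\<^esub> y \<in> ?I"
      have "z \<ominus>\<^bsub>B\<^esub> x \<in> ?I \<longleftrightarrow> z \<ominus>\<^bsub>B\<^esub> y \<in> ?I" if z: "z \<in> carrier B" for z
      proof -
        have 1: "z \<ominus>\<^bsub>B\<^esub> y = (z \<ominus>\<^bsub>B\<^esub> x) \<oplus>\<^bsub>B\<^esub> (x \<ominus>\<^bsub>B\<^esub> y)"
        proof -
          have "(z \<ominus>\<^bsub>B\<^esub> x) \<oplus>\<^bsub>B\<^esub> (x \<ominus>\<^bsub>B\<^esub> y) = z \<oplus>\<^bsub>B\<^esub> ((\<ominus>\<^bsub>B\<^esub> x \<oplus>\<^bsub>B\<^esub> x) \<oplus>\<^bsub>B\<^esub> \<ominus>\<^bsub>B\<^esub> y)"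
            using xy z by (simp add: B.minus_eq B.a_assoc del: B.l_neg)
          then show ?thesis using xy z by (simp add: B.minus_eq B.l_neg)
        qed
        have 2: "z \<ominus>\<^bsub>B\<^esub> x = (z \<ominus>\<^bsub>B\<^esub> y) \<oplus>\<^bsub>B\<^esub> \<ominus>\<^bsub>B\<^esub> (x \<ominus>\<^bsub>B\<^esub> y)"
          unfolding 1 using xy z by (simp add: B.a_assoc B.r_neg)
        show ?thesis using IE(5)[OF _ d] IE(5)[OF _ IE(3)[OF d]] 1 2 by metis
      qed
      then show "q x = q y" unfolding q_def by blast
    qed
    obtain D :: "('r, 'b set) module" where D: "module R D" "carrier D = q ` carrier B" "q \<in> mod_hom R B D"
      "\<And>x. x \<in> carrier B \<Longrightarrow> q x = \<zero>\<^bsub>D\<^esub> \<longleftrightarrow> x \<in> ?I"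
      by (rule quotient_module_exists[OF B I q]) blast+
    have ker: "b \<in> ?I" if b: "b \<in> carrier B" "g b = \<zero>\<^bsub>C\<^esub>" for b
    proof -
      have "q b = \<zero>\<^bsub>D\<^esub>"
      proof (rule faithfully_flat_elem_zero[OF ff D(1)])
        show "q b \<in> carrier D" using b D(2) by simp
        fix x assume x: "x \<in> carrier F"
        have "frag_of (x, \<zero>\<^bsub>C\<^esub>) \<in> tensor_ker R F C"
          by (rule tensor_ker_zero_right[OF F C]) (use x in simp)
        then obtain a where a: "Poly_Mapping.keys a \<subseteq> carrier F \<times> carrier A"
            "frag_of (x, b) - tensor_push id f a \<in> tensor_ker R F B"
          using ex[THEN conjunct2, rule_format, of "frag_of (x, b)"] b x by auto
        from tensor_push_ker[OF F B mod_hom_id D(3) F D(1) a(2)]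
        have 1: "frag_of (x, q b) - tensor_push id (q \<circ> f) a \<in> tensor_ker R F D"
          by (simp add: tensor_push_comp)
        have qf: "q (f u) = \<zero>\<^bsub>D\<^esub>" if "u \<in> carrier A" for u
          using D(4)[of "f u"] mod_homD(1)[OF f] that by simp
        have 2: "tensor_push id (q \<circ> f) a \<in> tensor_ker R F D"
          by (rule tensor_ker_zero_right[OF F D(1)], rule tensor_push_keys[OF a(1)]) (use qf in auto)
        show "frag_of (x, q b) \<in> tensor_ker R F D"
          using tensor_ker_add[OF 1 2] by simp
      qed
      then show ?thesis using D(4)[OF b(1)] by simp
    qed
    show "exact_at A f B g C"
      unfolding exact_at_def a_kernel_def' using gf ker mod_homD(1)[OF f] by auto
  qed
qed

end

(* Write (N : r) for the submodule of all m with r m in N. Over a um-ring, N is weakly classical prime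
   iff N is proper and, for all a and b, (N : ab) is contained in one of (0 : ab), (N : a), (N : b),
   because (N : ab) is the union of these three. Multiplication by r followed by M \<rightarrow> M / N has kernel
   (N : r), so tensoring with a flat module F turns (N : r) into (F \<otimes> N : r). Hence the containments are
   preserved by F \<otimes> -, and also reflected when F is faithfully flat. *)

theory Submission
  imports Defs
begin

section \<open>Quotients, and submodules of submodules\<close>

text \<open>Cosets serve as labels for \<open>quotient_module_exists\<close>. The projection turns
  membership in \<open>N\<close> into vanishing in a module, which is what the arguments about
  kernels and faithful flatness can handle.\<close>

lemma quotient_hom_exists:
  fixes A :: "('r, 'a, 'y) module_scheme"
  assumes A: "module R A" and N: "submodule N R A"
  obtains B :: "('r, 'a set) module" and q where "module R B" "q \<in> mod_hom R A B"
    "\<And>x. x \<in> carrier A \<Longrightarrow> q x = \<zero>\<^bsub>B\<^esub> \<longleftrightarrow> x \<in> N"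
proof -
  interpret A: module R A by fact
  interpret N: abelian_subgroup N A
    by (intro abelian_subgroupI3 additive_subgroup.intro submodule.axioms(1)[OF N] A.abelian_group_axioms)
  have q: "N +>\<^bsub>A\<^esub> x = N +>\<^bsub>A\<^esub> y \<longleftrightarrow> x \<ominus>\<^bsub>A\<^esub> y \<in> N" if xy: "x \<in> carrier A" "y \<in> carrier A" for x y
  proof -
    have "N +>\<^bsub>A\<^esub> x = N +>\<^bsub>A\<^esub> y \<longleftrightarrow> x \<in> N +>\<^bsub>A\<^esub> y"
      using N.a_rcos_self[OF xy(1)] A.a_repr_independence[OF _ xy(2) submodule.axioms(1)[OF N], of x] by auto
    then show ?thesis using N.a_rcos_module[OF xy(2,1)] by (simp add: A.minus_eq)
  qed
  show thesis
    by (rule quotient_module_exists[OF A N q]; (assumption | rule that)?; assumption?)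
qed

text \<open>The preimage of \<open>N\<close> under the inclusion of \<open>L\<close>. It lets
  residuals be viewed inside the submodule that they cover, where the um-property is
  applied.\<close>

lemma submodule_restrict:
  assumes "module R M" "submodule L R M" "submodule N R M" "N \<subseteq> L"
  shows "submodule N R (M\<lparr>carrier := L\<rparr>)"
proof -
  have "{x \<in> L. x \<in> N} = N" using assms(4) by blast
  then show ?thesis
    using submodule_vimage[OF submodule.submodule_is_module[OF assms(2,1)] assms(1)
        mod_hom_inclusion[OF assms(1,2)] assms(3)] by simp
qed

subsection \<open>Tensoring with a flat module\<close>

text \<open>Moves membership in the image of \<open>F \<otimes> N\<close> to representatives in the
  free abelian group, where the later lemmas do their calculations.\<close>

lemma tensor_coset_mem_submodule_iff:
  assumes F: "module R F" and M: "module R M" and N: "submodule N R M"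
  shows "tensor_ker R F M #>\<^bsub>tensor_free F M\<^esub> c \<in> tensor_submodule R F M N \<longleftrightarrow>
    (\<exists>a. Poly_Mapping.keys a \<subseteq> carrier F \<times> N \<and> c - a \<in> tensor_ker R F M)"
proof -
  note NM = submodule.submodule_is_module[OF N M]
  have "tensor_submodule R F M N =
      (\<lambda>a. tensor_ker R F M #>\<^bsub>tensor_free F M\<^esub> a) ` {a. Poly_Mapping.keys a \<subseteq> carrier F \<times> N}"
    by (simp add: tensor_submodule_def carrier_tensor_module image_image
        tensor_map_coset[OF F NM M mod_hom_inclusion[OF M N]] tensor_push_id)
  then show ?thesis by (auto simp: tensor_coset_eq_iff[OF F M])
qed

lemma submodule_tensor_submodule:
  assumes F: "module R F" and M: "module R M" and N: "submodule N R M"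
  shows "submodule (tensor_submodule R F M N) R (tensor_module R F M)"
proof -
  note NM = submodule.submodule_is_module[OF N M]
  show ?thesis
    unfolding tensor_submodule_def
    by (intro mod_hom_image_submodule[OF tensor_module_is_module[OF F NM] tensor_module_is_module[OF F M]]
        tensor_map_hom[OF F NM M mod_hom_inclusion[OF M N]])
qed

lemma tensor_submodule_subset:
  assumes "module R F" "module R M" "submodule N R M"
  shows "tensor_submodule R F M N \<subseteq> carrier (tensor_module R F M)"
  by (rule module.submoduleE(1)[OF tensor_module_is_module submodule_tensor_submodule]) (use assms in auto)

lemma tensor_submodule_mono:
  assumes F: "module R F" and M: "module R M" and N: "submodule N R M" and L: "submodule L R M"
    and sub: "N \<subseteq> L"
  shows "tensor_submodule R F M N \<subseteq> tensor_submodule R F M L"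
proof
  fix X assume X: "X \<in> tensor_submodule R F M N"
  then obtain c where c: "X = tensor_ker R F M #>\<^bsub>tensor_free F M\<^esub> c"
    using tensor_submodule_subset[OF F M N] by (auto simp: carrier_tensor_module)
  show "X \<in> tensor_submodule R F M L"
    using X sub unfolding c tensor_coset_mem_submodule_iff[OF F M N] tensor_coset_mem_submodule_iff[OF F M L]
    by blast
qed

lemma tensor_submodule_carrier:
  "module R F \<Longrightarrow> module R M \<Longrightarrow> tensor_submodule R F M (carrier M) = carrier (tensor_module R F M)"
  using image_cong[OF refl, of "carrier (tensor_module R F M)" "tensor_map R F M id" id]
  by (auto simp: tensor_submodule_def carrier_tensor_module image_image tensor_map_coset mod_hom_id tensor_push_id)

text \<open>Combinations of symbols with second entry zero vanish in the tensor product. This lets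
  the annihilator of a scalar be treated as a residual both before and after tensoring.\<close>

lemma tensor_submodule_zero:
  assumes F: "module R F" and M: "module R M"
  shows "tensor_submodule R F M {\<zero>\<^bsub>M\<^esub>} = {\<zero>\<^bsub>tensor_module R F M\<^esub>}"
proof -
  note Z = submodule_zero[OF M]
  have "X \<in> tensor_submodule R F M {\<zero>\<^bsub>M\<^esub>} \<longleftrightarrow> X = \<zero>\<^bsub>tensor_module R F M\<^esub>"
    if X: "X \<in> carrier (tensor_module R F M)" for X
  proof -
    from X obtain c where c: "X = tensor_ker R F M #>\<^bsub>tensor_free F M\<^esub> c"
      by (auto simp: carrier_tensor_module)
    have "(\<exists>a. Poly_Mapping.keys a \<subseteq> carrier F \<times> {\<zero>\<^bsub>M\<^esub>} \<and> c - a \<in> tensor_ker R F M)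
        \<longleftrightarrow> c \<in> tensor_ker R F M"
    proof
      assume "\<exists>a. Poly_Mapping.keys a \<subseteq> carrier F \<times> {\<zero>\<^bsub>M\<^esub>} \<and> c - a \<in> tensor_ker R F M"
      then obtain a where a: "Poly_Mapping.keys a \<subseteq> carrier F \<times> {\<zero>\<^bsub>M\<^esub>}" "c - a \<in> tensor_ker R F M"
        by blast
      show "c \<in> tensor_ker R F M"
        using tensor_ker_add[OF a(2) tensor_ker_zero_right[OF F M a(1)]] by simp
    next
      assume "c \<in> tensor_ker R F M"
      then show "\<exists>a. Poly_Mapping.keys a \<subseteq> carrier F \<times> {\<zero>\<^bsub>M\<^esub>} \<and> c - a \<in> tensor_ker R F M"
        by (intro exI[of _ 0]) simp
    qed
    then show ?thesis
      by (simp add: c tensor_coset_mem_submodule_iff[OF F M Z] zero_tensor_module tensor_coset_eq_iff[OF F M])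
  qed
  moreover have "\<zero>\<^bsub>tensor_module R F M\<^esub> \<in> carrier (tensor_module R F M)"
    by (auto simp: zero_tensor_module carrier_tensor_module)
  ultimately show ?thesis using tensor_submodule_subset[OF F M Z] by blast
qed

section \<open>Kernels and preimages under flat tensoring\<close>

text \<open>Factor \<open>g\<close> through its image. Flatness makes the map from
  \<open>F \<otimes> im g\<close> to \<open>F \<otimes> B\<close> injective, so the pushed element
  already vanishes over the image; right exactness, proved here by hand, then places
  \<open>c\<close> in the image of \<open>F \<otimes> ker g\<close>.\<close>

lemma tensor_kernel_flat:
  assumes flat: "flat_module R F" and A: "module R A" and B: "module R B" and g: "g \<in> mod_hom R A B"
    and c: "Poly_Mapping.keys c \<subseteq> carrier F \<times> carrier A" "tensor_push id g c \<in> tensor_ker R F B"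
  obtains a where "Poly_Mapping.keys a \<subseteq> carrier F \<times> {x \<in> carrier A. g x = \<zero>\<^bsub>B\<^esub>}"
    "c - a \<in> tensor_ker R F A"
proof -
  have F: "module R F" using flat by (simp add: flat_module_def)
  interpret F: module R F by fact
  interpret A: module R A by fact
  interpret B: module R B by fact
  define K where "K = {x \<in> carrier A. g x = \<zero>\<^bsub>B\<^esub>}"
  \<comment> \<open>\<open>P c\<close> says that the class of \<open>c\<close> lies in the image of
    \<open>F \<otimes> K\<close>. Closure of \<open>P\<close> under differences allows induction
    over generators and relations.\<close>
  define P where "P = (\<lambda>c. \<exists>a. Poly_Mapping.keys a \<subseteq> carrier F \<times> K \<and> c - a \<in> tensor_ker R F A)"
  have P_ker: "P c" if "c \<in> tensor_ker R F A" for c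
    using that unfolding P_def by (intro exI[of _ 0]) simp
  have P_diff: "P (c - d)" if cd: "P c" "P d" for c d
  proof -
    from cd obtain a b where "Poly_Mapping.keys a \<subseteq> carrier F \<times> K" "c - a \<in> tensor_ker R F A"
      "Poly_Mapping.keys b \<subseteq> carrier F \<times> K" "d - b \<in> tensor_ker R F A" unfolding P_def by blast
    then show ?thesis
      using keys_diff_subset[of a _ b] tensor_ker_diff[OF F A, of "c - a" "d - b"]
      unfolding P_def by (intro exI[of _ "a - b"]) (auto simp: algebra_simps)
  qed
  have P_0: "P 0" by (rule P_ker[OF tensor_ker_zero])
  have P_add: "P (c + d)" if "P c" "P d" for c d
    using P_diff[OF that(1) P_diff[OF P_0 that(2)]] by simp
  \<comment> \<open>Two lifts of the same element under \<open>g\<close> differ by an element of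
    \<open>K\<close>, so exchanging lifts in the second factor is harmless modulo
    \<open>P\<close>.\<close>
  have P_frag: "P (frag_of (x, y) - frag_of (x, z))"
    if *: "x \<in> carrier F" "y \<in> carrier A" "z \<in> carrier A" "g y = g z" for x y z
  proof -
    have yz: "z \<oplus>\<^bsub>A\<^esub> (y \<ominus>\<^bsub>A\<^esub> z) = y"
      using * by (simp add: A.minus_eq A.a_lcomm A.r_neg)
    have "frag_of (x, z \<oplus>\<^bsub>A\<^esub> (y \<ominus>\<^bsub>A\<^esub> z)) - frag_of (x, z) - frag_of (x, y \<ominus>\<^bsub>A\<^esub> z) \<in> tensor_rel R F A"
      using * unfolding tensor_rel_def by blast
    then have "frag_of (x, y) - frag_of (x, z) - frag_of (x, y \<ominus>\<^bsub>A\<^esub> z) \<in> tensor_ker R F A"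
      unfolding yz by (rule tensor_ker_rel)
    moreover have "y \<ominus>\<^bsub>A\<^esub> z \<in> K"
      using * mod_homD(1)[OF g, of z] by (simp add: K_def mod_hom_diff[OF A B g] B.minus_eq B.r_neg)
    ultimately show ?thesis
      using *(1) unfolding P_def by (intro exI[of _ "frag_of (x, y \<ominus>\<^bsub>A\<^esub> z)"]) auto
  qed
  let ?I = "g ` carrier A"
  have I: "submodule ?I R B" by (rule mod_hom_image_submodule[OF A B g])
  note IB = submodule.submodule_is_module[OF I B]
  have keys_gc: "Poly_Mapping.keys (tensor_push id g c) \<subseteq> carrier F \<times> ?I"
    by (rule tensor_push_keys[OF c(1)]) auto
  \<comment> \<open>The only use of flatness: it carries the vanishing from \<open>B\<close> down to
    the image of \<open>g\<close>, the domain on which lifts exist.\<close>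
  have "inj_on (tensor_map R F B id) (carrier (tensor_module R F (B\<lparr>carrier := ?I\<rparr>)))"
    by (rule flat_moduleD[OF flat IB B mod_hom_inclusion[OF B I]]) simp
  then have gc: "tensor_push id g c \<in> tensor_ker R F (B\<lparr>carrier := ?I\<rparr>)"
    using keys_gc c(2) unfolding inj_tensor_map_iff[OF F IB B mod_hom_inclusion[OF B I]]
    by (simp add: tensor_push_id)
  text \<open>A set-theoretic section \<open>s\<close> of \<open>g\<close> onto its image need not be linear, but \<open>id \<otimes> s\<close> is well
    defined modulo the image of \<open>F \<otimes> K\<close>, and there inverts \<open>id \<otimes> g\<close>.\<close>
  define s where "s = inv_into (carrier A) g"
  have s: "s y \<in> carrier A" "g (s y) = y" if "y \<in> ?I" for y
    using that by (simp_all add: s_def inv_into_into f_inv_into_f)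
  note IE = B.submoduleE[OF I]
  have "P (tensor_push id s (tensor_push id g c))"
    using F IB gc
  proof (induction rule: tensor_ker_induct)
    case zero
    then show ?case using P_0 by simp
  next
    case (rel c)
    then show ?case
    proof (cases rule: tensor_rel_cases)
      \<comment> \<open>Here the second entry is fixed, so \<open>s\<close> sends the relation to a
        genuine relation over \<open>A\<close>; the other two cases need a correction by
        \<open>P_frag\<close>.\<close>
      case (add_left x x' m)
      then have "frag_of (x \<oplus>\<^bsub>F\<^esub> x', s m) - frag_of (x, s m) - frag_of (x', s m) \<in> tensor_rel R F A"
        using s[of m] unfolding tensor_rel_def by auto
      then show ?thesis using P_ker[OF tensor_ker_rel] add_left(1) by simp
    next
      case (add_right x m m')
      then have m: "m \<in> ?I" "m' \<in> ?I" "m \<oplus>\<^bsub>B\<^esub> m' \<in> ?I" using IE(5) by auto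
      have "frag_of (x, s m \<oplus>\<^bsub>A\<^esub> s m') - frag_of (x, s m) - frag_of (x, s m') \<in> tensor_rel R F A"
        using s m add_right(2) unfolding tensor_rel_def by blast
      note rel = P_ker[OF tensor_ker_rel[OF this]]
      have "P (frag_of (x, s (m \<oplus>\<^bsub>B\<^esub> m')) - frag_of (x, s m \<oplus>\<^bsub>A\<^esub> s m'))"
        using s m add_right(2) by (intro P_frag) (simp_all add: mod_homD(2)[OF g])
      from P_add[OF this rel] show ?thesis by (simp add: add_right(1) algebra_simps)
    next
      case (smult r x m)
      then have m: "m \<in> ?I" "r \<odot>\<^bsub>B\<^esub> m \<in> ?I" using IE(4) by auto
      have "frag_of (r \<odot>\<^bsub>F\<^esub> x, s m) - frag_of (x, r \<odot>\<^bsub>A\<^esub> s m) \<in> tensor_rel R F A"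
        using s m smult(2,3) unfolding tensor_rel_def by blast
      note rel = P_ker[OF tensor_ker_rel[OF this]]
      have "P (frag_of (x, s (r \<odot>\<^bsub>B\<^esub> m)) - frag_of (x, r \<odot>\<^bsub>A\<^esub> s m))"
        using s m smult(2,3) by (intro P_frag) (simp_all add: mod_homD(3)[OF g])
      from P_diff[OF rel this] show ?thesis by (simp add: smult(1))
    qed
  next
    case (diff c d)
    then show ?case using P_diff by simp
  qed
  \<comment> \<open>On a generator, \<open>y\<close> and \<open>s (g y)\<close> have the same image
    under \<open>g\<close>, so \<open>P_frag\<close> applies; the general case follows by closure
    under differences.\<close>
  moreover have "P (c - tensor_push id s (tensor_push id g c))"
    using c(1)
  proof (induction c rule: frag_induction)
    case zero
    then show ?case using P_0 by simp
  next
    case (one a)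
    then show ?case using P_frag s mod_homD(1)[OF g] by (cases a) auto
  next
    case (diff a b)
    from P_diff[OF diff] show ?case by (simp add: algebra_simps)
  qed
  ultimately have "P c" using P_add by fastforce
  then show thesis using that unfolding P_def K_def by blast
qed

text \<open>The preimage of \<open>N\<close> is the kernel of \<open>f\<close> followed by the
  projection \<open>q\<close> onto \<open>B / N\<close>, so \<open>tensor_kernel_flat\<close> gives
  one inclusion. The other is functoriality of the tensor product.\<close>

lemma tensor_submodule_vimage:
  fixes B :: "('r, 'b, 'w) module_scheme"
  assumes flat: "flat_module R F" and A: "module R A" and B: "module R B" and f: "f \<in> mod_hom R A B"
    and N: "submodule N R B"
  shows "tensor_submodule R F A {x \<in> carrier A. f x \<in> N} =
    {X \<in> carrier (tensor_module R F A). tensor_map R F B f X \<in> tensor_submodule R F B N}"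
    (is "tensor_submodule R F A ?V = _")
proof -
  have F: "module R F" using flat by (simp add: flat_module_def)
  note V = submodule_vimage[OF A B f N]
  obtain Q :: "('r, 'b set) module" and q where Q: "module R Q" "q \<in> mod_hom R B Q"
    "\<And>x. x \<in> carrier B \<Longrightarrow> q x = \<zero>\<^bsub>Q\<^esub> \<longleftrightarrow> x \<in> N"
    using quotient_hom_exists[OF B N] by metis
  note qf = mod_hom_comp[OF f Q(2)]
  have V_eq: "?V = {x \<in> carrier A. (q \<circ> f) x = \<zero>\<^bsub>Q\<^esub>}"
    using Q(3) mod_homD(1)[OF f] by auto
  have "(\<exists>a. Poly_Mapping.keys a \<subseteq> carrier F \<times> ?V \<and> c - a \<in> tensor_ker R F A) \<longleftrightarrow>
    (\<exists>n. Poly_Mapping.keys n \<subseteq> carrier F \<times> N \<and> tensor_push id f c - n \<in> tensor_ker R F B)"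
    if c: "Poly_Mapping.keys c \<subseteq> carrier F \<times> carrier A" for c
  proof
    assume "\<exists>a. Poly_Mapping.keys a \<subseteq> carrier F \<times> ?V \<and> c - a \<in> tensor_ker R F A"
    then obtain a where a: "Poly_Mapping.keys a \<subseteq> carrier F \<times> ?V" "c - a \<in> tensor_ker R F A" by blast
    have "Poly_Mapping.keys (tensor_push id f a) \<subseteq> carrier F \<times> N"
      by (rule tensor_push_keys[OF a(1)]) auto
    then show "\<exists>n. Poly_Mapping.keys n \<subseteq> carrier F \<times> N \<and> tensor_push id f c - n \<in> tensor_ker R F B"
      using tensor_push_ker[OF F A mod_hom_id f F B a(2)] by auto
  next
    assume "\<exists>n. Poly_Mapping.keys n \<subseteq> carrier F \<times> N \<and> tensor_push id f c - n \<in> tensor_ker R F B"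
    then obtain n where n: "Poly_Mapping.keys n \<subseteq> carrier F \<times> N"
      "tensor_push id f c - n \<in> tensor_ker R F B" by blast
    \<comment> \<open>Since \<open>q\<close> kills \<open>N\<close>, pushing \<open>n\<close> along
      \<open>q\<close> gives only symbols with second entry zero. Hence the push of \<open>c\<close>
      along \<open>q \<circ> f\<close> vanishes in \<open>F \<otimes> Q\<close>.\<close>
    have "Poly_Mapping.keys (tensor_push id q n) \<subseteq> carrier F \<times> {\<zero>\<^bsub>Q\<^esub>}"
      by (rule tensor_push_keys[OF n(1)]) (use Q(3) module.submoduleE(1)[OF B N] in auto)
    from tensor_ker_add[OF tensor_push_ker[OF F B mod_hom_id Q(2) F Q(1) n(2)]
        tensor_ker_zero_right[OF F Q(1) this]]
    have "tensor_push id (q \<circ> f) c \<in> tensor_ker R F Q" by (simp add: tensor_push_comp)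
    from tensor_kernel_flat[OF flat A Q(1) qf c this]
    show "\<exists>a. Poly_Mapping.keys a \<subseteq> carrier F \<times> ?V \<and> c - a \<in> tensor_ker R F A"
      unfolding V_eq by blast
  qed
  note * = this
  have "X \<in> tensor_submodule R F A ?V \<longleftrightarrow> tensor_map R F B f X \<in> tensor_submodule R F B N"
    if X: "X \<in> carrier (tensor_module R F A)" for X
  proof -
    from X obtain c where c: "Poly_Mapping.keys c \<subseteq> carrier F \<times> carrier A"
      "X = tensor_ker R F A #>\<^bsub>tensor_free F A\<^esub> c" by (auto simp: carrier_tensor_module)
    show ?thesis
      unfolding c(2) tensor_map_coset[OF F A B f] tensor_coset_mem_submodule_iff[OF F A V]
        tensor_coset_mem_submodule_iff[OF F B N] by (rule *[OF c(1)])
  qed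
  then show ?thesis using tensor_submodule_subset[OF F A V] by blast
qed

text \<open>The action on the tensor product is defined through \<open>F\<close>, whereas residuals
  use multiplication on \<open>M\<close>. On generators the two differ by a scalar relation.\<close>

lemma tensor_map_smult:
  assumes F: "module R F" and M: "module R M" and r: "r \<in> carrier R"
    and X: "X \<in> carrier (tensor_module R F M)"
  shows "tensor_map R F M (\<lambda>m. r \<odot>\<^bsub>M\<^esub> m) X = r \<odot>\<^bsub>tensor_module R F M\<^esub> X"
proof -
  from X obtain c where c: "Poly_Mapping.keys c \<subseteq> carrier F \<times> carrier M"
    "X = tensor_ker R F M #>\<^bsub>tensor_free F M\<^esub> c" by (auto simp: carrier_tensor_module)
  have "tensor_push (\<lambda>x. r \<odot>\<^bsub>F\<^esub> x) id c - tensor_push id (\<lambda>m. r \<odot>\<^bsub>M\<^esub> m) c \<in> tensor_ker R F M"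
    using c(1)
  proof (induction c rule: frag_induction)
    case zero
    then show ?case by (simp add: tensor_ker_zero)
  next
    case (one a)
    then obtain x m where a: "a = (x, m)" "x \<in> carrier F" "m \<in> carrier M" by auto
    have "frag_of (r \<odot>\<^bsub>F\<^esub> x, m) - frag_of (x, r \<odot>\<^bsub>M\<^esub> m) \<in> tensor_rel R F M"
      using r a unfolding tensor_rel_def by blast
    then show ?case using tensor_ker_rel a(1) by simp
  next
    case (diff a b)
    from tensor_ker_diff[OF F M diff] show ?case by (simp add: algebra_simps)
  qed
  then show ?thesis
    unfolding c(2) tensor_map_coset[OF F M M mod_hom_smult[OF M r]] smult_tensor_module[OF F M r]
    by (metis tensor_coset_eq_iff[OF F M])
qed

subsection \<open>Residuals of a submodule by a scalar\<close>

text \<open>With \<open>N = {0}\<close> this is the annihilator of \<open>r\<close> in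
  \<open>M\<close>, so the exceptional case of a zero product is itself expressed by a
  residual.\<close>

definition scalar_colon :: "('r, 'm, 'y) module_scheme \<Rightarrow> 'm set \<Rightarrow> 'r \<Rightarrow> 'm set"
  where "scalar_colon M N r = {m \<in> carrier M. r \<odot>\<^bsub>M\<^esub> m \<in> N}"

lemma submodule_scalar_colon:
  assumes "module R M" "submodule N R M" "r \<in> carrier R"
  shows "submodule (scalar_colon M N r) R M"
  unfolding scalar_colon_def by (rule submodule_vimage[OF assms(1,1) mod_hom_smult[OF assms(1,3)] assms(2)])

text \<open>A residual is a preimage under multiplication by \<open>r\<close>, and this
  multiplication on \<open>M\<close> induces multiplication by \<open>r\<close> on the tensor
  product.\<close>

lemma tensor_submodule_scalar_colon:
  assumes flat: "flat_module R F" and M: "module R M" and N: "submodule N R M" and r: "r \<in> carrier R"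
  shows "tensor_submodule R F M (scalar_colon M N r) =
    scalar_colon (tensor_module R F M) (tensor_submodule R F M N) r"
proof -
  have F: "module R F" using flat by (simp add: flat_module_def)
  show ?thesis
    unfolding scalar_colon_def tensor_submodule_vimage[OF flat M M mod_hom_smult[OF M r] N]
    using tensor_map_smult[OF F M r] by auto
qed

text \<open>The um-property upgrades the pointwise alternative in the definition to an alternative between
  submodules, which can be compared before and after tensoring.\<close>

lemma weakly_classical_prime_iff:
  assumes um: "um_ring R" and M: "module R M" and N: "submodule N R M"
  shows "weakly_classical_prime R M N \<longleftrightarrow> N \<noteq> carrier M \<and>
    (\<forall>a\<in>carrier R. \<forall>b\<in>carrier R. \<exists>L\<in>{scalar_colon M {\<zero>\<^bsub>M\<^esub>} (a \<otimes>\<^bsub>R\<^esub> b), scalar_colon M N a, scalar_colon M N b}.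
       scalar_colon M N (a \<otimes>\<^bsub>R\<^esub> b) \<subseteq> L)" (is "_ \<longleftrightarrow> _ \<and> ?R")
proof -
  interpret M: module R M by fact
  note NE = M.submoduleE[OF N]
  have "?R \<longleftrightarrow> (\<forall>a\<in>carrier R. \<forall>b\<in>carrier R. \<forall>m\<in>carrier M.
       (a \<otimes>\<^bsub>R\<^esub> b) \<odot>\<^bsub>M\<^esub> m \<noteq> \<zero>\<^bsub>M\<^esub> \<longrightarrow> (a \<otimes>\<^bsub>R\<^esub> b) \<odot>\<^bsub>M\<^esub> m \<in> N \<longrightarrow>
       a \<odot>\<^bsub>M\<^esub> m \<in> N \<or> b \<odot>\<^bsub>M\<^esub> m \<in> N)"
  proof (intro ball_cong refl)
    fix a b assume ab: "a \<in> carrier R" "b \<in> carrier R"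
    let ?C = "scalar_colon M N (a \<otimes>\<^bsub>R\<^esub> b)"
    let ?S = "{scalar_colon M {\<zero>\<^bsub>M\<^esub>} (a \<otimes>\<^bsub>R\<^esub> b), scalar_colon M N a, scalar_colon M N b}"
    have C: "submodule ?C R M" using submodule_scalar_colon[OF M N] ab by simp
    have S: "submodule L R M" if "L \<in> ?S" for L
      using that ab submodule_scalar_colon[OF M N] submodule_scalar_colon[OF M submodule_zero[OF M]] by auto
    have "(a \<otimes>\<^bsub>R\<^esub> b) \<odot>\<^bsub>M\<^esub> m \<in> N" if "m \<in> carrier M" "a \<odot>\<^bsub>M\<^esub> m \<in> N \<or> b \<odot>\<^bsub>M\<^esub> m \<in> N" for m
      using that ab NE(4)[of a "b \<odot>\<^bsub>M\<^esub> m"] NE(4)[of b "a \<odot>\<^bsub>M\<^esub> m"]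
      by (metis M.smult_assoc1 M.R.m_comm)
    \<comment> \<open>These reverse inclusions turn a cover of \<open>?C\<close> into an equality
      with the union, as the um-property requires.\<close>
    then have sub: "L \<subseteq> ?C" if "L \<in> ?S" for L
      using that submodule_zero_mem[OF N] by (auto simp: scalar_colon_def)
    have "(\<exists>L\<in>?S. ?C \<subseteq> L) \<longleftrightarrow> ?C \<subseteq> \<Union>?S"
    proof
      assume "?C \<subseteq> \<Union>?S"
      then have "carrier (M\<lparr>carrier := ?C\<rparr>) = \<Union>?S" using sub by auto
      then have "carrier (M\<lparr>carrier := ?C\<rparr>) \<in> ?S"
        \<comment> \<open>The um-property is applied to \<open>?C\<close> as a module in its own
          right; it makes one of the three residuals equal to all of \<open>?C\<close>.\<close>
        using um_ringD[OF um submodule.submodule_is_module[OF C M], of ?S]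
          submodule_restrict[OF M C S sub] by blast
      then show "\<exists>L\<in>?S. ?C \<subseteq> L" by auto
    qed blast
    then show "(\<exists>L\<in>?S. ?C \<subseteq> L) \<longleftrightarrow> (\<forall>m\<in>carrier M.
        (a \<otimes>\<^bsub>R\<^esub> b) \<odot>\<^bsub>M\<^esub> m \<noteq> \<zero>\<^bsub>M\<^esub> \<longrightarrow> (a \<otimes>\<^bsub>R\<^esub> b) \<odot>\<^bsub>M\<^esub> m \<in> N \<longrightarrow>
        a \<odot>\<^bsub>M\<^esub> m \<in> N \<or> b \<odot>\<^bsub>M\<^esub> m \<in> N)"
      by (auto simp: scalar_colon_def)
  qed
  then show ?thesis using N unfolding weakly_classical_prime_def by blast
qed

subsection \<open>Flat and faithfully flat descent\<close>

text \<open>For the converse, let \<open>n\<close> lie in \<open>N\<close> and project to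
  \<open>M / L\<close>. Every \<open>x \<otimes> n\<close> lies in the image of
  \<open>F \<otimes> L\<close>, so every \<open>x \<otimes> q n\<close> is zero, and faithful
  flatness forces \<open>q n = 0\<close>.\<close>

lemma faithfully_flat_tensor_submodule_subset_iff:
  fixes M :: "('r, 'm, 'y) module_scheme"
  assumes ff: "faithfully_flat_module R F" and M: "module R M"
    and N: "submodule N R M" and L: "submodule L R M"
  shows "tensor_submodule R F M N \<subseteq> tensor_submodule R F M L \<longleftrightarrow> N \<subseteq> L"
proof
  have F: "module R F" using ff by (simp add: faithfully_flat_module_def)
  show "N \<subseteq> L \<Longrightarrow> tensor_submodule R F M N \<subseteq> tensor_submodule R F M L"
    by (rule tensor_submodule_mono[OF F M N L])
  assume sub: "tensor_submodule R F M N \<subseteq> tensor_submodule R F M L"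
  obtain Q :: "('r, 'm set) module" and q where Q: "module R Q" "q \<in> mod_hom R M Q"
    "\<And>x. x \<in> carrier M \<Longrightarrow> q x = \<zero>\<^bsub>Q\<^esub> \<longleftrightarrow> x \<in> L"
    using quotient_hom_exists[OF M L] by metis
  show "N \<subseteq> L"
  proof
    fix n assume n: "n \<in> N"
    then have nM: "n \<in> carrier M" using module.submoduleE(1)[OF M N] by blast
    have "q n = \<zero>\<^bsub>Q\<^esub>"
    proof (rule faithfully_flat_elem_zero[OF ff Q(1)])
      show "q n \<in> carrier Q" by (rule mod_homD(1)[OF Q(2) nM])
      fix x assume x: "x \<in> carrier F"
      have "tensor_ker R F M #>\<^bsub>tensor_free F M\<^esub> frag_of (x, n) \<in> tensor_submodule R F M N"
        unfolding tensor_coset_mem_submodule_iff[OF F M N]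
        using x n by (intro exI[of _ "frag_of (x, n)"]) (simp add: tensor_ker_zero)
      with sub obtain a where a: "Poly_Mapping.keys a \<subseteq> carrier F \<times> L"
        "frag_of (x, n) - a \<in> tensor_ker R F M"
        using tensor_coset_mem_submodule_iff[OF F M L] by blast
      have "Poly_Mapping.keys (tensor_push id q a) \<subseteq> carrier F \<times> {\<zero>\<^bsub>Q\<^esub>}"
        by (rule tensor_push_keys[OF a(1)]) (use Q(3) module.submoduleE(1)[OF M L] in auto)
      from tensor_ker_add[OF tensor_push_ker[OF F M mod_hom_id Q(2) F Q(1) a(2)]
          tensor_ker_zero_right[OF F Q(1) this]]
      show "frag_of (x, q n) \<in> tensor_ker R F Q" by simp
    qed
    then show "n \<in> L" using Q(3)[OF nM] by simp
  qed
qed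

text \<open>The um-criterion for \<open>F \<otimes> M\<close>, with its residuals rewritten as
  tensored residuals of \<open>M\<close>. It can then be compared inclusion by inclusion with the
  criterion for \<open>M\<close>.\<close>

lemma weakly_classical_prime_tensor_iff:
  assumes um: "um_ring R" and M: "module R M" and flat: "flat_module R F" and N: "submodule N R M"
  shows "weakly_classical_prime R (tensor_module R F M) (tensor_submodule R F M N) \<longleftrightarrow>
    tensor_submodule R F M N \<noteq> carrier (tensor_module R F M) \<and>
    (\<forall>a\<in>carrier R. \<forall>b\<in>carrier R. \<exists>L\<in>{scalar_colon M {\<zero>\<^bsub>M\<^esub>} (a \<otimes>\<^bsub>R\<^esub> b), scalar_colon M N a, scalar_colon M N b}.
       tensor_submodule R F M (scalar_colon M N (a \<otimes>\<^bsub>R\<^esub> b)) \<subseteq> tensor_submodule R F M L)"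
proof -
  have F: "module R F" using flat by (simp add: flat_module_def)
  interpret M: module R M by fact
  note T = tensor_module_is_module[OF F M] submodule_tensor_submodule[OF F M N]
  show ?thesis
    unfolding weakly_classical_prime_iff[OF um T]
    by (simp add: tensor_submodule_scalar_colon[OF flat M N] tensor_submodule_zero[OF F M]
        tensor_submodule_scalar_colon[OF flat M submodule_zero[OF M]])
qed

theorem theorem2p39:
  fixes R :: "('r, 'x) ring_scheme" and M :: "('r, 'm, 'y) module_scheme"
  assumes "um_ring R" and "module R M"
  shows "(\<forall>(F :: ('r, 'f, 'z) module_scheme) N.
            flat_module R F \<longrightarrow> weakly_classical_prime R M N \<longrightarrow>
            tensor_submodule R F M N \<noteq> carrier (tensor_module R F M) \<longrightarrow>
            weakly_classical_prime R (tensor_module R F M) (tensor_submodule R F M N)) \<and>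
         (\<forall>(F :: ('r, 'f, 'z) module_scheme) N.
            faithfully_flat_module R F \<longrightarrow> submodule N R M \<longrightarrow>
            (weakly_classical_prime R M N \<longleftrightarrow>
             weakly_classical_prime R (tensor_module R F M) (tensor_submodule R F M N)))"
proof (intro conjI allI impI)
  note um = assms(1) and M = assms(2)
  interpret M: module R M by (rule M)
  have colon: "submodule L R M"
    if "submodule N R M" "a \<in> carrier R" "b \<in> carrier R"
      "L \<in> {scalar_colon M {\<zero>\<^bsub>M\<^esub>} (a \<otimes>\<^bsub>R\<^esub> b), scalar_colon M N a, scalar_colon M N b,
         scalar_colon M N (a \<otimes>\<^bsub>R\<^esub> b)}" for N L a b
    using that submodule_scalar_colon[OF M that(1)] submodule_scalar_colon[OF M submodule_zero[OF M]] by auto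
  {
    fix F :: "('r, 'f, 'z) module_scheme" and N
    assume flat: "flat_module R F" and prime: "weakly_classical_prime R M N"
      and ne: "tensor_submodule R F M N \<noteq> carrier (tensor_module R F M)"
    have F: "module R F" using flat by (simp add: flat_module_def)
    have N: "submodule N R M" using prime by (simp add: weakly_classical_prime_def)
    show "weakly_classical_prime R (tensor_module R F M) (tensor_submodule R F M N)"
      unfolding weakly_classical_prime_tensor_iff[OF um M flat N]
    proof (intro conjI ballI ne)
      fix a b assume ab: "a \<in> carrier R" "b \<in> carrier R"
      then obtain L where L: "L \<in> {scalar_colon M {\<zero>\<^bsub>M\<^esub>} (a \<otimes>\<^bsub>R\<^esub> b), scalar_colon M N a, scalar_colon M N b}"
        "scalar_colon M N (a \<otimes>\<^bsub>R\<^esub> b) \<subseteq> L"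
        using prime unfolding weakly_classical_prime_iff[OF um M N] by blast
      \<comment> \<open>The same \<open>L\<close> that works before tensoring works afterwards, by
        monotonicity.\<close>
      have "tensor_submodule R F M (scalar_colon M N (a \<otimes>\<^bsub>R\<^esub> b)) \<subseteq> tensor_submodule R F M L"
        by (rule tensor_submodule_mono[OF F M colon[OF N ab] colon[OF N ab] L(2)]) (use L(1) in blast)+
      then show "\<exists>L\<in>{scalar_colon M {\<zero>\<^bsub>M\<^esub>} (a \<otimes>\<^bsub>R\<^esub> b), scalar_colon M N a, scalar_colon M N b}.
          tensor_submodule R F M (scalar_colon M N (a \<otimes>\<^bsub>R\<^esub> b)) \<subseteq> tensor_submodule R F M L"
        using L(1) by blast
    qed
  next
    fix F :: "('r, 'f, 'z) module_scheme" and N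
    assume ff: "faithfully_flat_module R F" and N: "submodule N R M"
    note flat = faithfully_flat_imp_flat[OF ff]
    have F: "module R F" using flat by (simp add: flat_module_def)
    have top: "submodule (carrier M) R M"
      using mod_hom_image_submodule[OF M M mod_hom_id] by simp
    \<comment> \<open>Properness is handled as the failure of the inclusion of \<open>M\<close> in
      \<open>N\<close>, so the comparison of submodules both preserves and reflects it.\<close>
    have "tensor_submodule R F M N = carrier (tensor_module R F M) \<longleftrightarrow> N = carrier M"
      using faithfully_flat_tensor_submodule_subset_iff[OF ff M top N] tensor_submodule_carrier[OF F M]
        tensor_submodule_subset[OF F M N] M.submoduleE(1)[OF N] by blast
    moreover have "tensor_submodule R F M (scalar_colon M N (a \<otimes>\<^bsub>R\<^esub> b)) \<subseteq> tensor_submodule R F M L \<longleftrightarrow>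
        scalar_colon M N (a \<otimes>\<^bsub>R\<^esub> b) \<subseteq> L"
      if "a \<in> carrier R" "b \<in> carrier R"
        "L \<in> {scalar_colon M {\<zero>\<^bsub>M\<^esub>} (a \<otimes>\<^bsub>R\<^esub> b), scalar_colon M N a, scalar_colon M N b}" for a b L
      by (rule faithfully_flat_tensor_submodule_subset_iff[OF ff M colon[OF N that(1,2)] colon[OF N that(1,2)]])
         (use that(3) in blast)+
    \<comment> \<open>The two criteria now agree clause by clause: properness, and each inclusion
      between residuals.\<close>
    ultimately show "weakly_classical_prime R M N \<longleftrightarrow>
        weakly_classical_prime R (tensor_module R F M) (tensor_submodule R F M N)"
      unfolding weakly_classical_prime_tensor_iff[OF um M flat N] weakly_classical_prime_iff[OF um M N]
      by (simp cong: ball_cong)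
  }
qed

end
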